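(* Let $(R,\mathfrak{m})$ be a local Noetherian ring, let $I \subset R$ be a proper ideal, and let $M$ be a Matlis reflexive $R$-module. Then $M$ is $I$-quasi-complete, i.e. the natural map $M \to \hat{M}^I$ to the $I$-adic completion is surjective. Moreover, $\hat{M}^I$ is Matlis reflexive as an $\hat{R}^I$-module as well as as an $R$-module.
   Context: For a local Noetherian ring $(A,\mathfrak{n})$, $E_A$ denotes the injective hull of the residue field $A/\mathfrak{n}$ as an $A$-module and $D_A(\cdot)=\operatorname{Hom}_A(\cdot,E_A)$ is the Matlis duality functor, with $D_A^2(M)=D_A(D_A(M))$. An $A$-module $M$ (not necessarily finitely generated) is called Matlis reflexive (over $A$) if the natural injective biduality homomorphism $M\to D_A^2(M)$, $m \mapsto (f\mapsto f(m))$, is an isomorphism. For an ideal $I$ of $R$ and an $R$-module $M$, $\hat{M}^I=\varprojlim_n M/I^nM$ is the $I$-adic completion of $M$; $\hat{R}^I$ is the $I$-adic completion of $R$, which is a local Noetherian ring, and $\hat{M}^I$ is a module over it. *)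

theory Defs
  imports "HOL-Algebra.Module" "HOL-Algebra.Ideal_Product" "HOL-Algebra.Ring_Divisibility"
begin

text \<open>
  The module records of HOL-Algebra extend its ring records.  The locale
  \<^locale>\<open>module\<close> ignores the fields \<open>mult\<close> and \<open>one\<close> of the module record,
  so these are left \<open>undefined\<close> in the modules constructed below.
\<close>

section \<open>Local Noetherian rings\<close>

definition local_noetherian_ring :: "('a, 'r) ring_scheme \<Rightarrow> 'a set \<Rightarrow> bool" where
  "local_noetherian_ring R \<mm> \<longleftrightarrow>
     cring R \<and> noetherian_ring R \<and> (\<forall>\<nn>. maximalideal \<nn> R \<longleftrightarrow> \<nn> = \<mm>)"


section \<open>Homomorphisms and quotients of modules\<close>

text \<open>Homomorphisms are extensional, so that equality in Hom modules is equality on the carrier.\<close>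

definition module_hom ::
  "('a, 'r) ring_scheme \<Rightarrow> ('a, 'b, 'm) module_scheme \<Rightarrow> ('a, 'c, 'n) module_scheme \<Rightarrow> ('b \<Rightarrow> 'c) set"
  where
  "module_hom R M N = {f \<in> carrier M \<rightarrow>\<^sub>E carrier N.
     (\<forall>x\<in>carrier M. \<forall>y\<in>carrier M. f (x \<oplus>\<^bsub>M\<^esub> y) = f x \<oplus>\<^bsub>N\<^esub> f y) \<and>
     (\<forall>r\<in>carrier R. \<forall>x\<in>carrier M. f (r \<odot>\<^bsub>M\<^esub> x) = r \<odot>\<^bsub>N\<^esub> f x)}"

definition module_iso ::
  "('a, 'r) ring_scheme \<Rightarrow> ('a, 'b, 'm) module_scheme \<Rightarrow> ('a, 'c, 'n) module_scheme \<Rightarrow> ('b \<Rightarrow> 'c) set"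
  where
  "module_iso R M N = {f \<in> module_hom R M N. bij_betw f (carrier M) (carrier N)}"

definition Hom_module ::
  "('a, 'r) ring_scheme \<Rightarrow> ('a, 'b, 'm) module_scheme \<Rightarrow> ('a, 'c, 'n) module_scheme
     \<Rightarrow> ('a, 'b \<Rightarrow> 'c) module"
  where
  "Hom_module R M N =
     \<lparr>carrier = module_hom R M N, monoid.mult = undefined, one = undefined,
      zero = (\<lambda>x\<in>carrier M. \<zero>\<^bsub>N\<^esub>),
      add = (\<lambda>f g. \<lambda>x\<in>carrier M. f x \<oplus>\<^bsub>N\<^esub> g x),
      smult = (\<lambda>r f. \<lambda>x\<in>carrier M. r \<odot>\<^bsub>N\<^esub> f x)\<rparr>"

definition self_module :: "('a, 'r) ring_scheme \<Rightarrow> ('a, 'a) module" where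
  "self_module R =
     \<lparr>carrier = carrier R, monoid.mult = (\<otimes>\<^bsub>R\<^esub>), one = \<one>\<^bsub>R\<^esub>, zero = \<zero>\<^bsub>R\<^esub>,
      add = (\<oplus>\<^bsub>R\<^esub>), smult = (\<otimes>\<^bsub>R\<^esub>)\<rparr>"

text \<open>
  Action of a set of scalars on a coset of \<open>N\<close>, in the style of \<^const>\<open>rcoset_mult\<close>.
  With \<open>A = {r}\<close> it is the action of a scalar \<open>r\<close> on \<open>M/N\<close>; with \<open>A\<close> a coset
  of an ideal \<open>J\<close> such that \<open>JM \<subseteq> N\<close> it is the action of \<open>R/J\<close> on \<open>M/N\<close>.
\<close>

definition coset_smult :: "('a, 'b, 'm) module_scheme \<Rightarrow> 'b set \<Rightarrow> 'a set \<Rightarrow> 'b set \<Rightarrow> 'b set" where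
  "coset_smult M N A X = (\<Union>a\<in>A. \<Union>x\<in>X. N +>\<^bsub>M\<^esub> (a \<odot>\<^bsub>M\<^esub> x))"

definition quotient_module :: "('a, 'b, 'm) module_scheme \<Rightarrow> 'b set \<Rightarrow> ('a, 'b set) module" where
  "quotient_module M N =
     \<lparr>carrier = a_rcosets\<^bsub>M\<^esub> N, monoid.mult = undefined, one = undefined,
      zero = N, add = set_add M, smult = (\<lambda>r. coset_smult M N {r})\<rparr>"

definition residue_field_module :: "('a, 'r) ring_scheme \<Rightarrow> 'a set \<Rightarrow> ('a, 'a set) module" where
  "residue_field_module R \<mm> = quotient_module (self_module R) \<mm>"


section \<open>Injective hulls and Matlis duality\<close>

text \<open>
  HOL cannot quantify over types inside a definition, so the extension property is required for
  monomorphisms between test modules whose elements have the same type as those of the ring.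
  These include all inclusions of ideals into the ring, so by Baer's criterion the property
  then holds for modules over arbitrary types.
\<close>

definition injective_module :: "('a, 'r) ring_scheme \<Rightarrow> ('a, 'e, 'x) module_scheme \<Rightarrow> bool" where
  "injective_module R E \<longleftrightarrow> module R E \<and>
     (\<forall>(N :: ('a, 'a) module) (L :: ('a, 'a) module) f g.
        module R N \<and> module R L \<and> f \<in> module_hom R N L \<and> inj_on f (carrier N) \<and> g \<in> module_hom R N E
        \<longrightarrow> (\<exists>h\<in>module_hom R L E. \<forall>x\<in>carrier N. h (f x) = g x))"

text \<open>\<open>E\<close> is an injective hull of \<open>K\<close>: an injective module that is an essential extension of \<open>K\<close>.\<close>

definition injective_hull ::
  "('a, 'r) ring_scheme \<Rightarrow> ('a, 'k, 'm) module_scheme \<Rightarrow> ('a, 'e, 'x) module_scheme \<Rightarrow> bool" where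
  "injective_hull R K E \<longleftrightarrow> module R K \<and> injective_module R E \<and>
     (\<exists>\<iota>\<in>module_hom R K E. inj_on \<iota> (carrier K) \<and>
        (\<forall>N. submodule N R E \<and> N \<noteq> {\<zero>\<^bsub>E\<^esub>} \<longrightarrow> N \<inter> \<iota> ` carrier K \<noteq> {\<zero>\<^bsub>E\<^esub>}))"

text \<open>
  The injective hull of the residue field, unique up to isomorphism only, is a parameter \<open>E\<close>
  of the dual \<open>D(M) = Hom(M, E)\<close> and of reflexivity.
\<close>

abbreviation matlis_dual ::
  "('a, 'r) ring_scheme \<Rightarrow> ('a, 'e, 'x) module_scheme \<Rightarrow> ('a, 'b, 'm) module_scheme
     \<Rightarrow> ('a, 'b \<Rightarrow> 'e) module" where
  "matlis_dual R E M \<equiv> Hom_module R M E"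

definition biduality ::
  "('a, 'r) ring_scheme \<Rightarrow> ('a, 'e, 'x) module_scheme \<Rightarrow> ('a, 'b, 'm) module_scheme
     \<Rightarrow> 'b \<Rightarrow> ('b \<Rightarrow> 'e) \<Rightarrow> 'e" where
  "biduality R E M = (\<lambda>x\<in>carrier M. \<lambda>f\<in>carrier (matlis_dual R E M). f x)"

definition matlis_reflexive ::
  "('a, 'r) ring_scheme \<Rightarrow> ('a, 'e, 'x) module_scheme \<Rightarrow> ('a, 'b, 'm) module_scheme \<Rightarrow> bool" where
  "matlis_reflexive R E M \<longleftrightarrow> module R M \<and>
     biduality R E M \<in> module_iso R M (matlis_dual R E (matlis_dual R E M))"


section \<open>Adic completions\<close>

abbreviation ideal_power :: "('a, 'r) ring_scheme \<Rightarrow> 'a set \<Rightarrow> nat \<Rightarrow> 'a set" where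
  "ideal_power R I n \<equiv> I [^]\<^bsub>ideals_set R\<^esub> n"

text \<open>The submodule \<open>JM\<close>; compare \<^const>\<open>ideal_prod\<close>.\<close>

inductive_set ideal_smult :: "('a, 'b, 'm) module_scheme \<Rightarrow> 'a set \<Rightarrow> 'b set"
  for M and J where
    smult: "\<lbrakk>a \<in> J; x \<in> carrier M\<rbrakk> \<Longrightarrow> a \<odot>\<^bsub>M\<^esub> x \<in> ideal_smult M J"
  | sum: "\<lbrakk>x \<in> ideal_smult M J; y \<in> ideal_smult M J\<rbrakk> \<Longrightarrow> x \<oplus>\<^bsub>M\<^esub> y \<in> ideal_smult M J"

abbreviation adic_submodule ::
  "('a, 'r) ring_scheme \<Rightarrow> 'a set \<Rightarrow> ('a, 'b, 'm) module_scheme \<Rightarrow> nat \<Rightarrow> 'b set" where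
  "adic_submodule R I M n \<equiv> ideal_smult M (ideal_power R I n)"

text \<open>
  Elements of the inverse limits below are compatible sequences of cosets.  For \<open>N \<subseteq> N'\<close>, the
  canonical map \<open>M/N \<rightarrow> M/N'\<close> sends a coset \<open>X\<close> to \<open>X + N'\<close>.
\<close>

definition completion_ring :: "('a, 'r) ring_scheme \<Rightarrow> 'a set \<Rightarrow> (nat \<Rightarrow> 'a set) ring" where
  "completion_ring R I =
     \<lparr>carrier = {A. (\<forall>n. A n \<in> carrier (R Quot ideal_power R I n)) \<and>
                    (\<forall>k n. k \<le> n \<longrightarrow> A k = A n <+>\<^bsub>R\<^esub> ideal_power R I k)},
      monoid.mult = (\<lambda>A B n. A n \<otimes>\<^bsub>R Quot ideal_power R I n\<^esub> B n),
      one = (\<lambda>n. \<one>\<^bsub>R Quot ideal_power R I n\<^esub>),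
      zero = (\<lambda>n. \<zero>\<^bsub>R Quot ideal_power R I n\<^esub>),
      add = (\<lambda>A B n. A n \<oplus>\<^bsub>R Quot ideal_power R I n\<^esub> B n)\<rparr>"

text \<open>The completion of \<open>M\<close> as an \<open>R\<close>-module.\<close>

definition completion ::
  "('a, 'r) ring_scheme \<Rightarrow> 'a set \<Rightarrow> ('a, 'b, 'm) module_scheme \<Rightarrow> ('a, nat \<Rightarrow> 'b set) module" where
  "completion R I M =
     \<lparr>carrier = {X. (\<forall>n. X n \<in> carrier (quotient_module M (adic_submodule R I M n))) \<and>
                    (\<forall>k n. k \<le> n \<longrightarrow> X k = X n <+>\<^bsub>M\<^esub> adic_submodule R I M k)},
      monoid.mult = undefined, one = undefined,
      zero = (\<lambda>n. \<zero>\<^bsub>quotient_module M (adic_submodule R I M n)\<^esub>),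
      add = (\<lambda>X Y n. X n \<oplus>\<^bsub>quotient_module M (adic_submodule R I M n)\<^esub> Y n),
      smult = (\<lambda>r X n. r \<odot>\<^bsub>quotient_module M (adic_submodule R I M n)\<^esub> X n)\<rparr>"

text \<open>
  The completion of \<open>M\<close> as a module over \<^const>\<open>completion_ring\<close>: the same abelian group,
  where a compatible sequence of scalars acts through the actions of \<open>R/I\<^sup>n\<close> on \<open>M/I\<^sup>nM\<close>.
\<close>

definition completion_hat ::
  "('a, 'r) ring_scheme \<Rightarrow> 'a set \<Rightarrow> ('a, 'b, 'm) module_scheme
     \<Rightarrow> (nat \<Rightarrow> 'a set, nat \<Rightarrow> 'b set) module" where
  "completion_hat R I M =
     \<lparr>carrier = carrier (completion R I M), monoid.mult = undefined, one = undefined,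
      zero = \<zero>\<^bsub>completion R I M\<^esub>, add = (\<oplus>\<^bsub>completion R I M\<^esub>),
      smult = (\<lambda>A X n. coset_smult M (adic_submodule R I M n) (A n) (X n))\<rparr>"

definition completion_map ::
  "('a, 'r) ring_scheme \<Rightarrow> 'a set \<Rightarrow> ('a, 'b, 'm) module_scheme \<Rightarrow> 'b \<Rightarrow> nat \<Rightarrow> 'b set" where
  "completion_map R I M = (\<lambda>x\<in>carrier M. \<lambda>n. adic_submodule R I M n +>\<^bsub>M\<^esub> x)"

definition quasi_complete ::
  "('a, 'r) ring_scheme \<Rightarrow> 'a set \<Rightarrow> ('a, 'b, 'm) module_scheme \<Rightarrow> bool" where
  "quasi_complete R I M \<longleftrightarrow> completion_map R I M ` carrier M = carrier (completion R I M)"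

end

theory Submission
  imports Defs
begin

text \<open>
  By Baer's criterion and Zorn's lemma \<open>E\<close> is injective for modules over all types, and it
  cogenerates.  Hence a compatible sequence \<open>x n\<close> in a reflexive \<open>M\<close> has a limit: the functional
  \<open>f \<mapsto> f (x n)\<close> on the union of the duals of \<open>M/I\<^sup>nM\<close> extends to the dual of \<open>M\<close>, so it is
  evaluation at some \<open>y\<close>.  Thus the completion is a quotient of \<open>M\<close>, and quotients of reflexive
  modules are reflexive.

  For the structure over the completed ring, the same compactness shows that every multiple of an
  element \<open>X\<close> of the completion of \<open>M\<close> by a scalar of the completed ring is a multiple by
  an element of \<open>R\<close>.  An \<open>R\<close>-linear \<open>p : E' \<rightarrow> E\<close>
  extending the identity of the residue field then embeds the dual over the completed ring into the
  dual over \<open>R\<close>, and biduality is inherited.  In particular flatness of the completed ring is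
  not needed.
\<close>


section \<open>Baer modules and extension of linear relations\<close>

text \<open>Functionals arise here on submodules of duals, and the modules live over many types.
  Partial maps are therefore sets of pairs whose consistency is tested only over zero. Each use of
  reflexivity has one shape: such a set of prescribed values is extended to the whole dual, and a
  point of evaluation is read off.

  The obstacle is the second ring. \<open>E'\<close> is a hull over the completed ring and
  \<open>E\<close> one over \<open>R\<close>; no isomorphism between them is at hand, and
  \<open>p\<close> may have a kernel. What excludes an element from this kernel is that its
  multiples by the completed ring are already multiples by \<open>R\<close>. This is known in the
  completion of \<open>M\<close>, not for arbitrary elements of \<open>E'\<close>. It has to be
  carried from a point \<open>X\<close> to the value \<open>f X\<close>, and then to
  \<open>f\<close> itself as an element of the dual, with one scalar valid at all points
  simultaneously. The last step is a separation argument that uses reflexivity over \<open>R\<close>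
  once more.

  Both hulls enter only through the element \<open>u\<close>: nonunits kill it, and every nonzero
  element has it as a multiple. Over the completed ring this rests on inverting elements outside a
  maximal ideal, which is reduced to units of \<open>R\<close> modulo \<open>I\<close>.\<close>

lemma (in abelian_group) minus_unique:
  assumes "x \<in> carrier G" "y \<in> carrier G" "x \<oplus> y = \<zero>"
  shows "y = \<ominus> x"
  using assms minus_equality[of y x] by (simp add: a_comm)

lemma (in abelian_group) diff_eq_zero_iff:
  assumes "x \<in> carrier G" "y \<in> carrier G"
  shows "x \<ominus> y = \<zero> \<longleftrightarrow> x = y"
proof
  assume "x \<ominus> y = \<zero>"
  then have "\<ominus> y = \<ominus> x"
    using assms by (intro minus_unique) (auto simp: a_minus_def)
  then show "x = y"
    using assms by (metis minus_minus)
qed (use assms in \<open>simp add: a_minus_def r_neg\<close>)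

lemma module_homI:
  assumes "\<And>x. x \<in> carrier M \<Longrightarrow> f x \<in> carrier N" and "\<And>x. x \<notin> carrier M \<Longrightarrow> f x = undefined"
    and "\<And>x y. x \<in> carrier M \<Longrightarrow> y \<in> carrier M \<Longrightarrow> f (x \<oplus>\<^bsub>M\<^esub> y) = f x \<oplus>\<^bsub>N\<^esub> f y"
    and "\<And>r x. r \<in> carrier R \<Longrightarrow> x \<in> carrier M \<Longrightarrow> f (r \<odot>\<^bsub>M\<^esub> x) = r \<odot>\<^bsub>N\<^esub> f x"
  shows "f \<in> module_hom R M N"
  using assms by (auto simp: module_hom_def PiE_def extensional_def)

lemma
  assumes "f \<in> module_hom R M N"
  shows module_hom_closed: "x \<in> carrier M \<Longrightarrow> f x \<in> carrier N"
    and module_hom_outside: "x \<notin> carrier M \<Longrightarrow> f x = undefined"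
    and module_hom_add: "x \<in> carrier M \<Longrightarrow> y \<in> carrier M \<Longrightarrow> f (x \<oplus>\<^bsub>M\<^esub> y) = f x \<oplus>\<^bsub>N\<^esub> f y"
    and module_hom_smult: "r \<in> carrier R \<Longrightarrow> x \<in> carrier M \<Longrightarrow> f (r \<odot>\<^bsub>M\<^esub> x) = r \<odot>\<^bsub>N\<^esub> f x"
  using assms by (auto simp: module_hom_def PiE_def extensional_def)

lemma module_hom_ext:
  assumes "f \<in> module_hom R M N" "g \<in> module_hom R M N" "\<And>x. x \<in> carrier M \<Longrightarrow> f x = g x"
  shows "f = g"
proof
  show "f x = g x" for x
    using assms(3) module_hom_outside[OF assms(1)] module_hom_outside[OF assms(2)]
    by (cases "x \<in> carrier M") auto
qed

lemma module_hom_zero: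
  assumes "module R M" "module R N" "f \<in> module_hom R M N"
  shows "f \<zero>\<^bsub>M\<^esub> = \<zero>\<^bsub>N\<^esub>"
proof -
  interpret M: module R M by fact
  interpret N: module R N by fact
  have "f (\<zero>\<^bsub>R\<^esub> \<odot>\<^bsub>M\<^esub> \<zero>\<^bsub>M\<^esub>) = \<zero>\<^bsub>R\<^esub> \<odot>\<^bsub>N\<^esub> f \<zero>\<^bsub>M\<^esub>"
    using assms by (intro module_hom_smult) auto
  then show ?thesis
    using module_hom_closed[OF assms(3), of "\<zero>\<^bsub>M\<^esub>"] by simp
qed

lemma module_hom_minus:
  assumes "module R M" "module R N" "f \<in> module_hom R M N" "x \<in> carrier M" "y \<in> carrier M"
  shows "f (x \<ominus>\<^bsub>M\<^esub> y) = f x \<ominus>\<^bsub>N\<^esub> f y"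
proof -
  interpret M: module R M by fact
  interpret N: module R N by fact
  have "f (\<ominus>\<^bsub>M\<^esub> y) = f ((\<ominus>\<^bsub>R\<^esub> \<one>\<^bsub>R\<^esub>) \<odot>\<^bsub>M\<^esub> y)"
    using assms by (simp add: M.smult_l_minus)
  also have "\<dots> = \<ominus>\<^bsub>N\<^esub> f y"
    using assms module_hom_closed[OF assms(3)]
    by (subst module_hom_smult[OF assms(3)]) (auto simp: N.smult_l_minus)
  finally show ?thesis
    using assms by (simp add: a_minus_def module_hom_add[OF assms(3)])
qed

text \<open>The graph of a linear map from a submodule of \<open>Q\<close> to \<open>E\<close>; the
  last clause makes it single valued, as differences stay in \<open>G\<close>. With sets of pairs,
  extension is inclusion, chains have their union as bound, and a map given on representatives is
  well defined as soon as the fibre over zero is trivial.\<close>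

definition linear_relation where
  "linear_relation R Q E G \<longleftrightarrow> G \<subseteq> carrier Q \<times> carrier E \<and> (\<zero>\<^bsub>Q\<^esub>, \<zero>\<^bsub>E\<^esub>) \<in> G \<and>
     (\<forall>x e y d. (x, e) \<in> G \<longrightarrow> (y, d) \<in> G \<longrightarrow> (x \<oplus>\<^bsub>Q\<^esub> y, e \<oplus>\<^bsub>E\<^esub> d) \<in> G) \<and>
     (\<forall>r x e. r \<in> carrier R \<longrightarrow> (x, e) \<in> G \<longrightarrow> (r \<odot>\<^bsub>Q\<^esub> x, r \<odot>\<^bsub>E\<^esub> e) \<in> G) \<and>
     (\<forall>e. (\<zero>\<^bsub>Q\<^esub>, e) \<in> G \<longrightarrow> e = \<zero>\<^bsub>E\<^esub>)"

lemma linear_relationI: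
  assumes "\<And>x e. (x, e) \<in> G \<Longrightarrow> x \<in> carrier Q" "\<And>x e. (x, e) \<in> G \<Longrightarrow> e \<in> carrier E"
    "(\<zero>\<^bsub>Q\<^esub>, \<zero>\<^bsub>E\<^esub>) \<in> G"
    "\<And>x e y d. (x, e) \<in> G \<Longrightarrow> (y, d) \<in> G \<Longrightarrow> (x \<oplus>\<^bsub>Q\<^esub> y, e \<oplus>\<^bsub>E\<^esub> d) \<in> G"
    "\<And>r x e. r \<in> carrier R \<Longrightarrow> (x, e) \<in> G \<Longrightarrow> (r \<odot>\<^bsub>Q\<^esub> x, r \<odot>\<^bsub>E\<^esub> e) \<in> G"
    "\<And>e. (\<zero>\<^bsub>Q\<^esub>, e) \<in> G \<Longrightarrow> e = \<zero>\<^bsub>E\<^esub>"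
  shows "linear_relation R Q E G"
  unfolding linear_relation_def by (intro conjI allI impI subrelI; simp add: assms)

lemma linear_relationD:
  assumes "linear_relation R Q E G"
  shows "(x, e) \<in> G \<Longrightarrow> x \<in> carrier Q" "(x, e) \<in> G \<Longrightarrow> e \<in> carrier E"
    "(\<zero>\<^bsub>Q\<^esub>, \<zero>\<^bsub>E\<^esub>) \<in> G"
    "(x, e) \<in> G \<Longrightarrow> (y, d) \<in> G \<Longrightarrow> (x \<oplus>\<^bsub>Q\<^esub> y, e \<oplus>\<^bsub>E\<^esub> d) \<in> G"
    "r \<in> carrier R \<Longrightarrow> (x, e) \<in> G \<Longrightarrow> (r \<odot>\<^bsub>Q\<^esub> x, r \<odot>\<^bsub>E\<^esub> e) \<in> G"
    "(\<zero>\<^bsub>Q\<^esub>, e) \<in> G \<Longrightarrow> e = \<zero>\<^bsub>E\<^esub>"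
  using assms unfolding linear_relation_def by blast+

lemma linear_relation_diff:
  assumes "module R Q" "module R E" "linear_relation R Q E G" "(x, e) \<in> G" "(y, d) \<in> G"
  shows "(x \<ominus>\<^bsub>Q\<^esub> y, e \<ominus>\<^bsub>E\<^esub> d) \<in> G"
proof -
  interpret Q: module R Q by fact
  interpret E: module R E by fact
  note G = linear_relationD[OF assms(3)]
  have "((\<ominus>\<^bsub>R\<^esub> \<one>\<^bsub>R\<^esub>) \<odot>\<^bsub>Q\<^esub> y, (\<ominus>\<^bsub>R\<^esub> \<one>\<^bsub>R\<^esub>) \<odot>\<^bsub>E\<^esub> d) \<in> G"
    using assms by (intro G(5)) auto
  then have "(\<ominus>\<^bsub>Q\<^esub> y, \<ominus>\<^bsub>E\<^esub> d) \<in> G"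
    using G(1,2)[OF assms(5)] by (simp add: Q.smult_l_minus E.smult_l_minus)
  with assms(4) show ?thesis
    unfolding a_minus_def by (rule G(4))
qed

lemma linear_relation_unique:
  assumes "module R Q" "module R E" "linear_relation R Q E G" "(x, e) \<in> G" "(x, d) \<in> G"
  shows "e = d"
proof -
  interpret Q: module R Q by fact
  interpret E: module R E by fact
  note G = linear_relationD[OF assms(3)]
  have "(\<zero>\<^bsub>Q\<^esub>, e \<ominus>\<^bsub>E\<^esub> d) \<in> G"
    using linear_relation_diff[OF assms] G(1)[OF assms(4)] by (simp add: a_minus_def Q.M.r_neg)
  then show ?thesis
    using G(6) G(2)[OF assms(4)] G(2)[OF assms(5)] E.M.diff_eq_zero_iff by blast
qed

text \<open>Injectivity in Baer's form: a linear map from an ideal to \<open>E\<close> is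
  multiplication by an element of \<open>E\<close>. It mentions elements of the ring only, so it
  carries no restriction on the types of test modules.\<close>

locale baer_module = module R E for R (structure) and E (structure) +
  assumes baer: "\<lbrakk>ideal J R; \<And>a. a \<in> J \<Longrightarrow> g a \<in> carrier E;
    \<And>a b. a \<in> J \<Longrightarrow> b \<in> J \<Longrightarrow> g (a \<oplus>\<^bsub>R\<^esub> b) = g a \<oplus>\<^bsub>E\<^esub> g b;
    \<And>r a. r \<in> carrier R \<Longrightarrow> a \<in> J \<Longrightarrow> g (r \<otimes>\<^bsub>R\<^esub> a) = r \<odot>\<^bsub>E\<^esub> g a\<rbrakk>
    \<Longrightarrow> \<exists>e\<in>carrier E. \<forall>a\<in>J. g a = a \<odot>\<^bsub>E\<^esub> e"
begin

text \<open>The scalars that carry \<open>x\<close> into the domain of \<open>G\<close> form an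
  ideal \<open>J\<close>, and \<open>G\<close> already prescribes the image of \<open>r x\<close>
  for \<open>r\<close> in \<open>J\<close>. Baer's condition turns this prescription into
  multiplication by one element \<open>e\<close>, which can then serve as the value at
  \<open>x\<close>.\<close>

lemma extend_by_one:
  assumes Q: "module R Q" and G: "linear_relation R Q E G" and x: "x \<in> carrier Q"
  shows "\<exists>G' e. linear_relation R Q E G' \<and> G \<subseteq> G' \<and> (x, e) \<in> G'"
proof -
  interpret Q: module R Q by fact
  note GD = linear_relationD[OF G]
  note unique = linear_relation_unique[OF Q module_axioms G]
  define J where "J = {r \<in> carrier R. \<exists>e. (r \<odot>\<^bsub>Q\<^esub> x, e) \<in> G}"
  define g where "g r = (THE e. (r \<odot>\<^bsub>Q\<^esub> x, e) \<in> G)" for r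
  have g: "(r \<odot>\<^bsub>Q\<^esub> x, g r) \<in> G" if "r \<in> J" for r
    unfolding g_def by (rule theI') (use that unique in \<open>auto simp: J_def\<close>)
  have g_eq: "g r = e" if "(r \<odot>\<^bsub>Q\<^esub> x, e) \<in> G" for r e
    unfolding g_def by (rule the_equality) (use that unique in blast)+
  have add: "((a \<oplus>\<^bsub>R\<^esub> b) \<odot>\<^bsub>Q\<^esub> x, g a \<oplus>\<^bsub>E\<^esub> g b) \<in> G" if "a \<in> J" "b \<in> J" for a b
    using GD(4)[OF g[OF that(1)] g[OF that(2)]] that x by (simp add: J_def Q.smult_l_distr)
  have mult: "((r \<otimes>\<^bsub>R\<^esub> a) \<odot>\<^bsub>Q\<^esub> x, r \<odot>\<^bsub>E\<^esub> g a) \<in> G" if "r \<in> carrier R" "a \<in> J" for r a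
    using GD(5)[OF that(1) g[OF that(2)]] that x by (simp add: J_def Q.smult_assoc1)
  have J: "ideal J R"
  proof (rule idealI)
    show "ring R" ..
    show "subgroup J (add_monoid R)"
    proof (rule R.add.subgroupI)
      have "\<zero> \<in> J"
        using x GD(3) by (auto simp: J_def)
      then show "J \<noteq> {}" by blast
      show "\<ominus> a \<in> J" if "a \<in> J" for a
        using mult[of "\<ominus> \<one>" a] that by (auto simp: J_def R.l_minus)
    qed (use add in \<open>auto simp: J_def\<close>)
    show *: "a \<otimes> r \<in> J" if "r \<in> J" "a \<in> carrier R" for a r
      using mult[OF that(2,1)] that by (auto simp: J_def)
    show "r \<otimes> a \<in> J" if "r \<in> J" "a \<in> carrier R" for a r
    proof -
      have "r \<in> carrier R" using that by (simp add: J_def)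
      then show ?thesis using *[OF that] that by (simp add: R.m_comm)
    qed
  qed
  obtain e where e: "e \<in> carrier E" and ge: "\<And>a. a \<in> J \<Longrightarrow> g a = a \<odot>\<^bsub>E\<^esub> e"
    using baer[OF J, of g] GD(2)[OF g] g_eq[OF add] g_eq[OF mult] by blast
  define G' where "G' = {(y \<oplus>\<^bsub>Q\<^esub> r \<odot>\<^bsub>Q\<^esub> x, d \<oplus>\<^bsub>E\<^esub> r \<odot>\<^bsub>E\<^esub> e) | y d r. (y, d) \<in> G \<and> r \<in> carrier R}"
  have G'I: "(y', d') \<in> G'"
    if "(y, d) \<in> G" "r \<in> carrier R" "y' = y \<oplus>\<^bsub>Q\<^esub> r \<odot>\<^bsub>Q\<^esub> x" "d' = d \<oplus>\<^bsub>E\<^esub> r \<odot>\<^bsub>E\<^esub> e" for y d y' d' r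
    using that unfolding G'_def by blast
  have sub: "G \<subseteq> G'"
  proof clarify
    fix y d assume "(y, d) \<in> G"
    then show "(y, d) \<in> G'"
      using GD(1,2) x e by (intro G'I[of y d "\<zero>"]) auto
  qed
  moreover have "(x, e) \<in> G'"
    using GD(3) x e by (intro G'I[of "\<zero>\<^bsub>Q\<^esub>" "\<zero>\<^bsub>E\<^esub>" "\<one>"]) auto
  moreover have "linear_relation R Q E G'"
  proof (rule linear_relationI)
    show "(\<zero>\<^bsub>Q\<^esub>, \<zero>\<^bsub>E\<^esub>) \<in> G'"
      using GD(3) sub by blast
    show "y \<in> carrier Q" "d \<in> carrier E" if "(y, d) \<in> G'" for y d
      using that x e GD(1,2) unfolding G'_def by auto
    show "(y \<oplus>\<^bsub>Q\<^esub> y', d \<oplus>\<^bsub>E\<^esub> d') \<in> G'" if yd: "(y, d) \<in> G'" "(y', d') \<in> G'" for y d y' d'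
    proof -
      obtain z c r where 1: "(z, c) \<in> G" "r \<in> carrier R"
          "y = z \<oplus>\<^bsub>Q\<^esub> r \<odot>\<^bsub>Q\<^esub> x" "d = c \<oplus>\<^bsub>E\<^esub> r \<odot>\<^bsub>E\<^esub> e"
        using yd(1) unfolding G'_def by blast
      obtain z' c' r' where 2: "(z', c') \<in> G" "r' \<in> carrier R"
          "y' = z' \<oplus>\<^bsub>Q\<^esub> r' \<odot>\<^bsub>Q\<^esub> x" "d' = c' \<oplus>\<^bsub>E\<^esub> r' \<odot>\<^bsub>E\<^esub> e"
        using yd(2) unfolding G'_def by blast
      show ?thesis
        using 1 2 GD(1,2) x e
        by (intro G'I[OF GD(4)[OF 1(1) 2(1)], of "r \<oplus> r'"])
          (auto simp: Q.smult_l_distr smult_l_distr Q.a_ac M.a_ac)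
    qed
    show "(r \<odot>\<^bsub>Q\<^esub> y, r \<odot>\<^bsub>E\<^esub> d) \<in> G'" if r: "r \<in> carrier R" and yd: "(y, d) \<in> G'" for r y d
    proof -
      obtain z c s where 1: "(z, c) \<in> G" "s \<in> carrier R"
          "y = z \<oplus>\<^bsub>Q\<^esub> s \<odot>\<^bsub>Q\<^esub> x" "d = c \<oplus>\<^bsub>E\<^esub> s \<odot>\<^bsub>E\<^esub> e"
        using yd unfolding G'_def by blast
      show ?thesis
        using 1 r GD(1,2) x e
        by (intro G'I[OF GD(5)[OF r 1(1)], of "r \<otimes> s"])
          (auto simp: Q.smult_r_distr smult_r_distr Q.smult_assoc1 smult_assoc1)
    qed
    \<comment> \<open>A relation \<open>z + r x = 0\<close> puts \<open>r\<close> into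
      \<open>J\<close>, so \<open>r e\<close> is the value that \<open>G\<close> prescribes at
      \<open>r x = - z\<close>, namely \<open>- c\<close>.\<close>
    show "d = \<zero>\<^bsub>E\<^esub>" if yd: "(\<zero>\<^bsub>Q\<^esub>, d) \<in> G'" for d
    proof -
      obtain z c r where 1: "(z, c) \<in> G" "r \<in> carrier R"
          "\<zero>\<^bsub>Q\<^esub> = z \<oplus>\<^bsub>Q\<^esub> r \<odot>\<^bsub>Q\<^esub> x" "d = c \<oplus>\<^bsub>E\<^esub> r \<odot>\<^bsub>E\<^esub> e"
        using yd unfolding G'_def by blast
      have z: "z \<in> carrier Q" "c \<in> carrier E" using GD(1,2) 1 by blast+
      have "r \<odot>\<^bsub>Q\<^esub> x = \<ominus>\<^bsub>Q\<^esub> z"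
        using 1 z x by (intro Q.M.minus_unique) auto
      moreover have "(\<ominus>\<^bsub>Q\<^esub> z, \<ominus>\<^bsub>E\<^esub> c) \<in> G"
        using linear_relation_diff[OF Q module_axioms G GD(3) 1(1)] z
        by (simp add: a_minus_def)
      ultimately have *: "(r \<odot>\<^bsub>Q\<^esub> x, \<ominus>\<^bsub>E\<^esub> c) \<in> G" by simp
      then have "r \<in> J" using 1 by (auto simp: J_def)
      then have "r \<odot>\<^bsub>E\<^esub> e = \<ominus>\<^bsub>E\<^esub> c" using g_eq[OF *] ge by simp
      then show ?thesis using 1 z by (simp add: M.r_neg)
    qed
  qed
  ultimately show ?thesis by blast
qed

text \<open>A linear relation that is maximal above \<open>G0\<close> is defined everywhere, since
  \<open>extend_by_one\<close> cannot enlarge it; any two pairs in the union of a chain already lie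
  in a common member.\<close>

theorem extend_relation:
  assumes Q: "module R Q" and G0: "linear_relation R Q E G0"
  shows "\<exists>f\<in>module_hom R Q E. \<forall>(x, e)\<in>G0. f x = e"
proof -
  interpret Q: module R Q by fact
  define \<G> where "\<G> = {G. linear_relation R Q E G \<and> G0 \<subseteq> G}"
  have "\<exists>G\<in>\<G>. \<forall>H\<in>\<G>. G \<subseteq> H \<longrightarrow> H = G"
  proof (rule subset_Zorn_nonempty)
    show "\<G> \<noteq> {}" using G0 by (auto simp: \<G>_def)
    fix \<C> assume "\<C> \<noteq> {}" and chain: "subset.chain \<G> \<C>"
    then obtain C0 where C0: "C0 \<in> \<C>" by blast
    have lin: "linear_relation R Q E C" if "C \<in> \<C>" for C
      using chain that by (auto simp: subset.chain_def \<G>_def)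
    have "linear_relation R Q E (\<Union>\<C>)"
    proof (rule linear_relationI)
      show "(\<zero>\<^bsub>Q\<^esub>, \<zero>\<^bsub>E\<^esub>) \<in> \<Union>\<C>" using C0 linear_relationD(3)[OF lin] by blast
      show "(x \<oplus>\<^bsub>Q\<^esub> y, e \<oplus>\<^bsub>E\<^esub> d) \<in> \<Union>\<C>" if xy: "(x, e) \<in> \<Union>\<C>" "(y, d) \<in> \<Union>\<C>" for x e y d
      proof -
        obtain C D where "C \<in> \<C>" "D \<in> \<C>" "(x, e) \<in> C" "(y, d) \<in> D" using xy by blast
        moreover from this have "C \<subseteq> D \<or> D \<subseteq> C"
          using chain by (auto simp: subset_chain_def)
        ultimately show ?thesis
          using linear_relationD(4)[OF lin] by (meson UnionI subsetD)
      qed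
    qed (auto dest: linear_relationD[OF lin])
    moreover have "G0 \<subseteq> \<Union>\<C>"
      using C0 chain by (auto simp: subset.chain_def \<G>_def)
    ultimately show "\<Union>\<C> \<in> \<G>" by (simp add: \<G>_def)
  qed
  then obtain G where G: "linear_relation R Q E G" "G0 \<subseteq> G"
    and max: "\<And>H. linear_relation R Q E H \<Longrightarrow> G \<subseteq> H \<Longrightarrow> H = G"
    unfolding \<G>_def by (smt (verit) mem_Collect_eq subset_trans)
  note GD = linear_relationD[OF G(1)]
  note unique = linear_relation_unique[OF Q module_axioms G(1)]
  have total: "\<exists>e. (x, e) \<in> G" if "x \<in> carrier Q" for x
    using extend_by_one[OF Q G(1) that] max by blast
  define f where "f = (\<lambda>x\<in>carrier Q. THE e. (x, e) \<in> G)"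
  have f: "(x, f x) \<in> G" if "x \<in> carrier Q" for x
  proof -
    have "(x, THE e. (x, e) \<in> G) \<in> G"
      by (rule theI') (use total[OF that] unique in blast)
    then show ?thesis using that by (simp add: f_def)
  qed
  have f_eq: "f x = e" if "(x, e) \<in> G" for x e
    using unique[OF f that] GD(1)[OF that] by blast
  have "f \<in> module_hom R Q E"
  proof (rule module_homI)
    show "f x \<in> carrier E" if "x \<in> carrier Q" for x using f[OF that] GD(2) by blast
    show "f x = undefined" if "x \<notin> carrier Q" for x using that by (simp add: f_def)
  qed (auto intro!: f_eq GD(4,5) f)
  then show ?thesis using f_eq G(2) by blast
qed

end

text \<open>\<open>E\<close> is an essential extension of the residue field, which is spanned by \<open>u\<close>.\<close>

locale matlis = baer_module +
  fixes u
  assumes u_carrier: "u \<in> carrier E" and u_nonzero: "u \<noteq> \<zero>\<^bsub>E\<^esub>"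
    and nonunit_smult_u: "\<lbrakk>r \<in> carrier R; r \<notin> Units R\<rbrakk> \<Longrightarrow> r \<odot>\<^bsub>E\<^esub> u = \<zero>\<^bsub>E\<^esub>"
    and essential: "\<lbrakk>e \<in> carrier E; e \<noteq> \<zero>\<^bsub>E\<^esub>\<rbrakk> \<Longrightarrow> \<exists>r\<in>carrier R. r \<odot>\<^bsub>E\<^esub> e = u"
begin

text \<open>Extend the functional \<open>y + r x \<mapsto> r u\<close> from \<open>N + R x\<close>.
  It is well defined: if \<open>r x\<close> lies in \<open>N\<close>, then \<open>r\<close> is not a
  unit, because \<open>x\<close> is outside \<open>N\<close>, and nonunits annihilate
  \<open>u\<close>.\<close>

lemma cogenerator:
  assumes Q: "module R Q" and N: "submodule N R Q" and x: "x \<in> carrier Q" "x \<notin> N"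
  obtains f where "f \<in> module_hom R Q E" "\<And>y. y \<in> N \<Longrightarrow> f y = \<zero>\<^bsub>E\<^esub>" "f x \<noteq> \<zero>\<^bsub>E\<^esub>"
proof -
  interpret Q: module R Q by fact
  note ND = Q.submoduleE[OF N]
  have N0: "\<zero>\<^bsub>Q\<^esub> \<in> N"
    using ND(1,2,4) by (metis Q.smult_l_null R.zero_closed ex_in_conv subsetD)
  define G where "G = {(y \<oplus>\<^bsub>Q\<^esub> r \<odot>\<^bsub>Q\<^esub> x, r \<odot>\<^bsub>E\<^esub> u) | y r. y \<in> N \<and> r \<in> carrier R}"
  have GI: "(y', d') \<in> G"
    if "y \<in> N" "r \<in> carrier R" "y' = y \<oplus>\<^bsub>Q\<^esub> r \<odot>\<^bsub>Q\<^esub> x" "d' = r \<odot>\<^bsub>E\<^esub> u" for y y' d' r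
    using that unfolding G_def by blast
  have "linear_relation R Q E G"
  proof (rule linear_relationI)
    show "(\<zero>\<^bsub>Q\<^esub>, \<zero>\<^bsub>E\<^esub>) \<in> G"
      using x u_carrier N0 by (intro GI[of "\<zero>\<^bsub>Q\<^esub>" "\<zero>"]) auto
    show "y \<in> carrier Q" "d \<in> carrier E" if "(y, d) \<in> G" for y d
      using that x u_carrier ND(1) unfolding G_def by auto
    show "(y \<oplus>\<^bsub>Q\<^esub> y', d \<oplus>\<^bsub>E\<^esub> d') \<in> G" if yd: "(y, d) \<in> G" "(y', d') \<in> G" for y d y' d'
    proof -
      obtain z r where 1: "z \<in> N" "r \<in> carrier R" "y = z \<oplus>\<^bsub>Q\<^esub> r \<odot>\<^bsub>Q\<^esub> x" "d = r \<odot>\<^bsub>E\<^esub> u"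
        using yd(1) unfolding G_def by blast
      obtain z' r' where 2: "z' \<in> N" "r' \<in> carrier R" "y' = z' \<oplus>\<^bsub>Q\<^esub> r' \<odot>\<^bsub>Q\<^esub> x" "d' = r' \<odot>\<^bsub>E\<^esub> u"
        using yd(2) unfolding G_def by blast
      have "z \<in> carrier Q" "z' \<in> carrier Q" using 1 2 ND(1) by auto
      then show ?thesis
        using 1 2 x u_carrier
        by (intro GI[OF ND(5)[OF 1(1) 2(1)], of "r \<oplus> r'"])
          (auto simp: Q.smult_l_distr smult_l_distr Q.a_ac M.a_ac)
    qed
    show "(r \<odot>\<^bsub>Q\<^esub> y, r \<odot>\<^bsub>E\<^esub> d) \<in> G" if r: "r \<in> carrier R" and yd: "(y, d) \<in> G" for r y d
    proof -
      obtain z s where 1: "z \<in> N" "s \<in> carrier R" "y = z \<oplus>\<^bsub>Q\<^esub> s \<odot>\<^bsub>Q\<^esub> x" "d = s \<odot>\<^bsub>E\<^esub> u"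
        using yd unfolding G_def by blast
      have "z \<in> carrier Q" using 1 ND(1) by auto
      then show ?thesis
        using 1 r x u_carrier
        by (intro GI[OF ND(4)[OF r 1(1)], of "r \<otimes> s"])
          (auto simp: Q.smult_r_distr smult_r_distr Q.smult_assoc1 smult_assoc1)
    qed
    show "d = \<zero>\<^bsub>E\<^esub>" if yd: "(\<zero>\<^bsub>Q\<^esub>, d) \<in> G" for d
    proof -
      obtain z r where 1: "z \<in> N" "r \<in> carrier R" "\<zero>\<^bsub>Q\<^esub> = z \<oplus>\<^bsub>Q\<^esub> r \<odot>\<^bsub>Q\<^esub> x" "d = r \<odot>\<^bsub>E\<^esub> u"
        using yd unfolding G_def by blast
      have z: "z \<in> carrier Q" using ND(1) 1 by blast
      have "r \<odot>\<^bsub>Q\<^esub> x = \<ominus>\<^bsub>Q\<^esub> z"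
        using 1 z x by (intro Q.M.minus_unique) auto
      then have rx: "r \<odot>\<^bsub>Q\<^esub> x \<in> N" using ND(3) 1 by simp
      have "r \<notin> Units R"
      proof
        assume r: "r \<in> Units R"
        then have "inv r \<odot>\<^bsub>Q\<^esub> (r \<odot>\<^bsub>Q\<^esub> x) \<in> N" using rx ND(4) by blast
        then show False
          using r x 1 by (simp flip: Q.smult_assoc1)
      qed
      then show ?thesis using 1 nonunit_smult_u by simp
    qed
  qed
  from extend_relation[OF Q this] obtain f where f: "f \<in> module_hom R Q E" "\<forall>(x, e)\<in>G. f x = e" by blast
  have "f y = \<zero>\<^bsub>E\<^esub>" if "y \<in> N" for y
  proof -
    have "(y, \<zero>\<^bsub>E\<^esub>) \<in> G"
      using that ND(1) x u_carrier by (intro GI[of y "\<zero>"]) auto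
    then show ?thesis using f by auto
  qed
  moreover have "f x \<noteq> \<zero>\<^bsub>E\<^esub>"
  proof -
    have "(x, u) \<in> G"
      using N0 x u_carrier by (intro GI[of "\<zero>\<^bsub>Q\<^esub>" "\<one>"]) auto
    then show ?thesis using f u_nonzero by auto
  qed
  ultimately show ?thesis using that f by blast
qed

end


section \<open>Duals and reflexive modules\<close>

lemma Hom_module_simps [simp]:
  "carrier (Hom_module R M N) = module_hom R M N"
  "\<zero>\<^bsub>Hom_module R M N\<^esub> = (\<lambda>x\<in>carrier M. \<zero>\<^bsub>N\<^esub>)"
  "f \<oplus>\<^bsub>Hom_module R M N\<^esub> g = (\<lambda>x\<in>carrier M. f x \<oplus>\<^bsub>N\<^esub> g x)"
  "r \<odot>\<^bsub>Hom_module R M N\<^esub> f = (\<lambda>x\<in>carrier M. r \<odot>\<^bsub>N\<^esub> f x)"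
  by (simp_all add: Hom_module_def)

lemma module_Hom_module:
  assumes "module R M" "module R N"
  shows "module R (Hom_module R M N)"
proof -
  interpret M: module R M by fact
  interpret N: module R N by fact
  note hom = module_hom_closed module_hom_add module_hom_smult
  have zero: "(\<lambda>x\<in>carrier M. \<zero>\<^bsub>N\<^esub>) \<in> module_hom R M N"
    by (rule module_homI) auto
  have add: "(\<lambda>x\<in>carrier M. f x \<oplus>\<^bsub>N\<^esub> g x) \<in> module_hom R M N"
    if "f \<in> module_hom R M N" "g \<in> module_hom R M N" for f g
    by (rule module_homI)
      (auto simp: hom[OF that(1)] hom[OF that(2)] N.smult_r_distr N.M.a_ac)
  have smult: "(\<lambda>x\<in>carrier M. r \<odot>\<^bsub>N\<^esub> f x) \<in> module_hom R M N"
    if "r \<in> carrier R" "f \<in> module_hom R M N" for r f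
  proof (rule module_homI)
    fix s x assume "s \<in> carrier R" "x \<in> carrier M"
    then show "(\<lambda>x\<in>carrier M. r \<odot>\<^bsub>N\<^esub> f x) (s \<odot>\<^bsub>M\<^esub> x) = s \<odot>\<^bsub>N\<^esub> (\<lambda>x\<in>carrier M. r \<odot>\<^bsub>N\<^esub> f x) x"
      using that(1) M.R.m_comm[of r s]
      by (simp add: hom[OF that(2)] flip: N.smult_assoc1)
  qed (use that(1) in \<open>auto simp: hom[OF that(2)] N.smult_r_distr\<close>)
  show ?thesis
  proof (rule moduleI)
    show "cring R" by (rule M.R.is_cring)
    show "abelian_group (Hom_module R M N)"
    proof (rule abelian_groupI)
      fix f assume f: "f \<in> carrier (Hom_module R M N)"
      then have f': "f \<in> module_hom R M N" by simp
      show "\<zero>\<^bsub>Hom_module R M N\<^esub> \<oplus>\<^bsub>Hom_module R M N\<^esub> f = f"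
        by (rule ext) (simp add: hom[OF f'] module_hom_outside[OF f'] restrict_def)
      show "\<exists>g\<in>carrier (Hom_module R M N). g \<oplus>\<^bsub>Hom_module R M N\<^esub> f = \<zero>\<^bsub>Hom_module R M N\<^esub>"
      proof
        show "(\<lambda>x\<in>carrier M. (\<ominus>\<^bsub>R\<^esub> \<one>\<^bsub>R\<^esub>) \<odot>\<^bsub>N\<^esub> f x) \<in> carrier (Hom_module R M N)"
          using smult[of "\<ominus>\<^bsub>R\<^esub> \<one>\<^bsub>R\<^esub>" f] f by simp
        show "(\<lambda>x\<in>carrier M. (\<ominus>\<^bsub>R\<^esub> \<one>\<^bsub>R\<^esub>) \<odot>\<^bsub>N\<^esub> f x) \<oplus>\<^bsub>Hom_module R M N\<^esub> f = \<zero>\<^bsub>Hom_module R M N\<^esub>"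
          by (rule ext) (simp add: hom[OF f'] N.smult_l_minus N.M.l_neg restrict_def)
      qed
    next
      fix f g h
      assume "f \<in> carrier (Hom_module R M N)" "g \<in> carrier (Hom_module R M N)"
        "h \<in> carrier (Hom_module R M N)"
      then show "f \<oplus>\<^bsub>Hom_module R M N\<^esub> g \<oplus>\<^bsub>Hom_module R M N\<^esub> h
          = f \<oplus>\<^bsub>Hom_module R M N\<^esub> (g \<oplus>\<^bsub>Hom_module R M N\<^esub> h)"
        by (intro ext) (simp add: hom restrict_def N.M.a_assoc)
    next
      fix f g assume "f \<in> carrier (Hom_module R M N)" "g \<in> carrier (Hom_module R M N)"
      then show "f \<oplus>\<^bsub>Hom_module R M N\<^esub> g = g \<oplus>\<^bsub>Hom_module R M N\<^esub> f"
        by (intro ext) (simp add: hom restrict_def N.M.a_comm)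
    qed (use zero add in auto)
  next
    fix f assume "f \<in> carrier (Hom_module R M N)"
    then have f': "f \<in> module_hom R M N" by simp
    show "\<one>\<^bsub>R\<^esub> \<odot>\<^bsub>Hom_module R M N\<^esub> f = f"
      by (rule ext) (simp add: hom[OF f'] module_hom_outside[OF f'] restrict_def)
  next
    fix a b f assume "a \<in> carrier R" "b \<in> carrier R" "f \<in> carrier (Hom_module R M N)"
    then show "(a \<oplus>\<^bsub>R\<^esub> b) \<odot>\<^bsub>Hom_module R M N\<^esub> f
        = a \<odot>\<^bsub>Hom_module R M N\<^esub> f \<oplus>\<^bsub>Hom_module R M N\<^esub> b \<odot>\<^bsub>Hom_module R M N\<^esub> f"
      "a \<otimes>\<^bsub>R\<^esub> b \<odot>\<^bsub>Hom_module R M N\<^esub> f = a \<odot>\<^bsub>Hom_module R M N\<^esub> (b \<odot>\<^bsub>Hom_module R M N\<^esub> f)"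
      by (auto intro!: ext simp: hom restrict_def N.smult_l_distr N.smult_assoc1)
  next
    fix a f g
    assume "a \<in> carrier R" "f \<in> carrier (Hom_module R M N)" "g \<in> carrier (Hom_module R M N)"
    then show "a \<odot>\<^bsub>Hom_module R M N\<^esub> (f \<oplus>\<^bsub>Hom_module R M N\<^esub> g)
        = a \<odot>\<^bsub>Hom_module R M N\<^esub> f \<oplus>\<^bsub>Hom_module R M N\<^esub> a \<odot>\<^bsub>Hom_module R M N\<^esub> g"
      by (intro ext) (simp add: hom restrict_def N.smult_r_distr)
  qed (use smult in auto)
qed

lemma module_hom_comp:
  assumes "module R M" "h \<in> module_hom R M N" "g \<in> module_hom R N L"
  shows "(\<lambda>x\<in>carrier M. g (h x)) \<in> module_hom R M L"
proof -
  interpret M: module R M by fact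
  note hom = module_hom_closed module_hom_add module_hom_smult
  show ?thesis
    by (rule module_homI) (auto simp: hom[OF assms(2)] hom[OF assms(3)])
qed

section \<open>Submodules of the form \<open>J x\<close> and \<open>J M\<close>\<close>

lemma (in module) submodule_zero: "submodule N R M \<Longrightarrow> \<zero>\<^bsub>M\<^esub> \<in> N"
  using submoduleE(1,2,4) by (metis smult_l_null R.zero_closed ex_in_conv subsetD)

text \<open>With \<open>J = R\<close> this yields the cyclic submodules used for separation and
  essentiality, among them the zero submodule for \<open>x = 0\<close>; with \<open>J = I^n\<close>
  it yields the filtration of a cyclic module.\<close>

lemma (in module) submodule_multiples:
  assumes J: "ideal J R" and x: "x \<in> carrier M"
  shows "submodule ((\<lambda>r. r \<odot>\<^bsub>M\<^esub> x) ` J) R M"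
proof -
  interpret J: ideal J R by fact
  show ?thesis
  proof (rule submoduleI)
    show "\<zero>\<^bsub>M\<^esub> \<in> (\<lambda>r. r \<odot>\<^bsub>M\<^esub> x) ` J"
      using x J.zero_closed by (metis image_eqI smult_l_null)
    show "\<ominus>\<^bsub>M\<^esub> a \<in> (\<lambda>r. r \<odot>\<^bsub>M\<^esub> x) ` J" if "a \<in> (\<lambda>r. r \<odot>\<^bsub>M\<^esub> x) ` J" for a
      using that x J.a_inv_closed J.Icarr by (auto simp flip: smult_l_minus)
    show "a \<oplus>\<^bsub>M\<^esub> b \<in> (\<lambda>r. r \<odot>\<^bsub>M\<^esub> x) ` J"
      if "a \<in> (\<lambda>r. r \<odot>\<^bsub>M\<^esub> x) ` J" "b \<in> (\<lambda>r. r \<odot>\<^bsub>M\<^esub> x) ` J" for a b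
      using that x J.a_closed J.Icarr by (auto simp flip: smult_l_distr)
    show "r \<odot>\<^bsub>M\<^esub> a \<in> (\<lambda>r. r \<odot>\<^bsub>M\<^esub> x) ` J"
      if "r \<in> carrier R" "a \<in> (\<lambda>r. r \<odot>\<^bsub>M\<^esub> x) ` J" for r a
      using that x J.I_l_closed J.Icarr by (auto simp flip: smult_assoc1)
  qed (use x J.Icarr in auto)
qed

text \<open>\<open>ideal_smult\<close> is generated by products and sums alone; zero comes from the
  zero of \<open>J\<close>, and negatives from the scalar -1.\<close>

lemma (in module) submodule_ideal_smult:
  assumes J: "ideal J R"
  shows "submodule (ideal_smult M J) R M"
proof -
  interpret J: ideal J R by fact
  have sub: "x \<in> carrier M" if "x \<in> ideal_smult M J" for x
    using that by induction (auto simp: J.Icarr)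
  have mult: "r \<odot>\<^bsub>M\<^esub> x \<in> ideal_smult M J" if "r \<in> carrier R" "x \<in> ideal_smult M J" for r x
    using that(2)
  proof induction
    case (smult a x)
    then have "r \<otimes> a \<in> J" using that(1) J.I_l_closed by blast
    from ideal_smult.smult[OF this smult(2)] show ?case
      using that(1) smult J.Icarr by (simp add: smult_assoc1)
  next
    case (sum x y)
    then show ?case
      using that(1) sub by (simp add: smult_r_distr ideal_smult.sum)
  qed
  show ?thesis
  proof (rule submoduleI)
    show "ideal_smult M J \<subseteq> carrier M" using sub by blast
    show "\<zero>\<^bsub>M\<^esub> \<in> ideal_smult M J"
      using ideal_smult.smult[OF J.zero_closed M.zero_closed] by simp
    show "\<ominus>\<^bsub>M\<^esub> x \<in> ideal_smult M J" if "x \<in> ideal_smult M J" for x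
      using mult[of "\<ominus> \<one>" x] that sub by (simp add: smult_l_minus)
  qed (use mult ideal_smult.sum in auto)
qed

section \<open>Reflexivity as representability of functionals on the dual by points\<close>

context matlis
begin

lemma module_dual: "module R M \<Longrightarrow> module R (matlis_dual R E M)"
  by (rule module_Hom_module) (auto intro: module_axioms)

lemma hom_diff_eq_zero_iff:
  assumes "module R Q" "f \<in> module_hom R Q E" "x \<in> carrier Q" "y \<in> carrier Q"
  shows "f (x \<ominus>\<^bsub>Q\<^esub> y) = \<zero>\<^bsub>E\<^esub> \<longleftrightarrow> f x = f y"
  using assms module_hom_closed[OF assms(2)]
  by (simp add: module_hom_minus[OF assms(1) module_axioms] M.diff_eq_zero_iff)

text \<open>Only surjectivity is at stake: biduality is always linear, and it is injective because
  functionals separate points from the zero submodule.\<close>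

lemma biduality_in_module_iso_iff:
  assumes M: "module R M"
  shows "biduality R E M \<in> module_iso R M (matlis_dual R E (matlis_dual R E M)) \<longleftrightarrow>
    (\<forall>\<phi>\<in>module_hom R (matlis_dual R E M) E. \<exists>x\<in>carrier M. \<forall>f\<in>module_hom R M E. \<phi> f = f x)"
proof -
  interpret M: module R M by fact
  let ?D = "matlis_dual R E M"
  interpret D: module R ?D using M by (rule module_dual)
  note hom = module_hom_closed module_hom_add module_hom_smult
  have ev: "(\<lambda>f\<in>module_hom R M E. f x) \<in> module_hom R ?D E" if "x \<in> carrier M" for x
    by (rule module_homI) (use that D.smult_closed D.M.a_closed in \<open>auto simp: hom\<close>)
  have hom: "biduality R E M \<in> module_hom R M (matlis_dual R E ?D)"
  proof (rule module_homI)
    show "biduality R E M x \<in> carrier (matlis_dual R E ?D)" if "x \<in> carrier M" for x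
      using that ev by (simp add: biduality_def)
  qed (auto simp: biduality_def hom fun_eq_iff)
  have inj: "inj_on (biduality R E M) (carrier M)"
  proof (rule inj_onI)
    fix x y assume x: "x \<in> carrier M" "y \<in> carrier M" and eq: "biduality R E M x = biduality R E M y"
    have fxy: "f x = f y" if "f \<in> module_hom R M E" for f
      using fun_cong[OF eq, of f] x that by (simp add: biduality_def)
    \<comment> \<open>The zero submodule, written as the multiples of zero.\<close>
    have "x \<ominus>\<^bsub>M\<^esub> y \<in> (\<lambda>r. r \<odot>\<^bsub>M\<^esub> \<zero>\<^bsub>M\<^esub>) ` carrier R"
    proof (rule ccontr)
      assume "\<not> ?thesis"
      then obtain f where f: "f \<in> module_hom R M E" "f (x \<ominus>\<^bsub>M\<^esub> y) \<noteq> \<zero>\<^bsub>E\<^esub>"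
        using cogenerator[OF M M.submodule_multiples[OF R.oneideal M.M.zero_closed], of "x \<ominus>\<^bsub>M\<^esub> y"] x
        by blast
      then show False
        using x fxy hom_diff_eq_zero_iff[OF M f(1)] by simp
    qed
    then show "x = y"
      using x by (auto simp: M.M.diff_eq_zero_iff)
  qed
  have "bij_betw (biduality R E M) (carrier M) (module_hom R ?D E) \<longleftrightarrow>
    module_hom R ?D E \<subseteq> biduality R E M ` carrier M"
    using inj module_hom_closed[OF hom] by (auto simp: bij_betw_def)
  also have "\<dots> \<longleftrightarrow>
    (\<forall>\<phi>\<in>module_hom R ?D E. \<exists>x\<in>carrier M. \<forall>f\<in>module_hom R M E. \<phi> f = f x)"
  proof (intro iffI ballI subsetI)
    fix \<phi> assume "module_hom R ?D E \<subseteq> biduality R E M ` carrier M" "\<phi> \<in> module_hom R ?D E"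
    then obtain x where "x \<in> carrier M" "\<phi> = biduality R E M x" by blast
    then show "\<exists>x\<in>carrier M. \<forall>f\<in>module_hom R M E. \<phi> f = f x"
      by (intro bexI[of _ x]) (auto simp: biduality_def)
  next
    fix \<phi> assume "\<forall>\<phi>\<in>module_hom R ?D E. \<exists>x\<in>carrier M. \<forall>f\<in>module_hom R M E. \<phi> f = f x"
      and \<phi>: "\<phi> \<in> module_hom R ?D E"
    then obtain x where x: "x \<in> carrier M" "\<And>f. f \<in> module_hom R M E \<Longrightarrow> \<phi> f = f x" by blast
    have "\<phi> = (\<lambda>f\<in>module_hom R M E. f x)"
      using x by (intro module_hom_ext[OF \<phi> ev]) auto
    then show "\<phi> \<in> biduality R E M ` carrier M"
      using x(1) by (intro image_eqI[of _ _ x]) (auto simp: biduality_def)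
  qed
  finally show ?thesis using hom by (simp add: module_iso_def)
qed

lemma matlis_reflexive_iff:
  "matlis_reflexive R E M \<longleftrightarrow> module R M \<and>
    (\<forall>\<phi>\<in>module_hom R (matlis_dual R E M) E. \<exists>x\<in>carrier M. \<forall>f\<in>module_hom R M E. \<phi> f = f x)"
  unfolding matlis_reflexive_def using biduality_in_module_iso_iff by blast

text \<open>The working form of reflexivity: values prescribed consistently on some functionals of
  \<open>M\<close> extend to the whole dual, and are therefore taken at a point of
  \<open>M\<close>.\<close>

lemma reflexive_relation:
  assumes "matlis_reflexive R E M" "linear_relation R (matlis_dual R E M) E G"
  obtains x where "x \<in> carrier M" "\<And>f e. (f, e) \<in> G \<Longrightarrow> f x = e"
proof -
  have M: "module R M" using assms(1) by (simp add: matlis_reflexive_iff)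
  obtain \<phi> where \<phi>: "\<phi> \<in> module_hom R (matlis_dual R E M) E" "\<forall>(f, e)\<in>G. \<phi> f = e"
    using extend_relation[OF module_dual[OF M] assms(2)] by blast
  with assms(1) obtain x where "x \<in> carrier M" "\<And>f. f \<in> module_hom R M E \<Longrightarrow> \<phi> f = f x"
    unfolding matlis_reflexive_iff by blast
  with \<phi> linear_relationD(1)[OF assms(2)] show ?thesis
    by (intro that[of x]) fastforce+
qed

text \<open>
  Reflexive modules are linearly compact for countable filtrations: \<open>f \<mapsto> f (x n)\<close> is a
  well-defined functional on the maps killing some \<open>N n\<close>, and it is an evaluation.
\<close>

lemma reflexive_linearly_compact:
  assumes refl: "matlis_reflexive R E M"
    and N: "\<And>n. submodule (N n) R M" and dec: "\<And>k n. k \<le> n \<Longrightarrow> N n \<subseteq> N k"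
    and x: "\<And>n. x n \<in> carrier M" and compat: "\<And>k n. k \<le> n \<Longrightarrow> x n \<ominus>\<^bsub>M\<^esub> x k \<in> N k"
  obtains y where "y \<in> carrier M" "\<And>n::nat. y \<ominus>\<^bsub>M\<^esub> x n \<in> N n"
proof -
  have M: "module R M" using refl by (simp add: matlis_reflexive_iff)
  interpret M: module R M by fact
  define U where "U n = {f \<in> module_hom R M E. \<forall>y\<in>N n. f y = \<zero>\<^bsub>E\<^esub>}" for n
  \<comment> \<open>The annihilators \<open>U n\<close> grow with \<open>n\<close>, and a functional
    that kills \<open>N k\<close> takes one value on all \<open>x n\<close> with
    \<open>k \<le> n\<close>. So the value recorded in \<open>G\<close> depends on the functional
    and not on the level.\<close>
  have U_le: "f \<in> U n \<and> f (x n) = f (x k)" if f: "f \<in> U k" and "k \<le> n" for f k n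
  proof -
    have "f \<in> module_hom R M E" "f (x n \<ominus>\<^bsub>M\<^esub> x k) = \<zero>\<^bsub>E\<^esub>"
      using f compat[OF \<open>k \<le> n\<close>] by (auto simp: U_def)
    then have "f (x n) = f (x k)"
      using x hom_diff_eq_zero_iff[OF M] by blast
    then show ?thesis using f dec[OF \<open>k \<le> n\<close>] by (auto simp: U_def)
  qed
  define G where "G = {(f, f (x n)) | f n. f \<in> U n}"
  have "linear_relation R (matlis_dual R E M) E G"
  proof (rule linear_relationI)
    fix f e assume fe: "(f, e) \<in> G"
    show "f \<in> carrier (matlis_dual R E M)" "e \<in> carrier E"
      using fe x by (auto simp: G_def U_def module_hom_closed)
  next
    have "(\<lambda>z\<in>carrier M. \<zero>\<^bsub>E\<^esub>) \<in> U 0"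
      using module_dual[OF M] module.axioms(2) abelian_group.axioms(1) abelian_monoid.zero_closed
        M.submoduleE(1)[OF N] unfolding U_def by fastforce
    then show "(\<zero>\<^bsub>matlis_dual R E M\<^esub>, \<zero>\<^bsub>E\<^esub>) \<in> G"
      using x by (auto simp: G_def intro!: exI[of _ 0])
  next
    fix f e g d assume "(f, e) \<in> G" "(g, d) \<in> G"
    then obtain m n where 1: "f \<in> U m" "e = f (x m)" "g \<in> U n" "d = g (x n)"
      by (auto simp: G_def)
    \<comment> \<open>The two functionals may be recorded at different levels; both persist at the
      later one with unchanged values.\<close>
    define l where "l = max m n"
    have 2: "f \<in> U l" "e = f (x l)" "g \<in> U l" "d = g (x l)"
      using 1 U_le[of f m l] U_le[of g n l] by (auto simp: l_def)
    have "f \<oplus>\<^bsub>matlis_dual R E M\<^esub> g \<in> U l"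
      using 2 abelian_monoid.a_closed[OF abelian_group.axioms(1)[OF module.axioms(2)[OF module_dual[OF M]]], of f g]
        M.submoduleE(1)[OF N] by (auto simp: U_def)
    then show "(f \<oplus>\<^bsub>matlis_dual R E M\<^esub> g, e \<oplus>\<^bsub>E\<^esub> d) \<in> G"
      using x 2 by (auto simp: G_def intro!: exI[of _ l])
  next
    fix r f e assume r: "r \<in> carrier R" and "(f, e) \<in> G"
    then obtain m where 1: "f \<in> U m" "e = f (x m)"
      by (auto simp: G_def)
    have "r \<odot>\<^bsub>matlis_dual R E M\<^esub> f \<in> U m"
      using 1 r module.smult_closed[OF module_dual[OF M], of r f]
        M.submoduleE(1)[OF N] by (auto simp: U_def)
    then show "(r \<odot>\<^bsub>matlis_dual R E M\<^esub> f, r \<odot>\<^bsub>E\<^esub> e) \<in> G"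
      using x 1 by (auto simp: G_def intro!: exI[of _ m])
  qed (use x in \<open>auto simp: G_def\<close>)
  from reflexive_relation[OF refl this] obtain y where y: "y \<in> carrier M" "\<And>f e. (f, e) \<in> G \<Longrightarrow> f y = e"
    by blast
  have "y \<ominus>\<^bsub>M\<^esub> x n \<in> N n" for n
  proof (rule ccontr)
    assume "y \<ominus>\<^bsub>M\<^esub> x n \<notin> N n"
    then obtain f where f: "f \<in> module_hom R M E" "\<And>z. z \<in> N n \<Longrightarrow> f z = \<zero>\<^bsub>E\<^esub>"
        "f (y \<ominus>\<^bsub>M\<^esub> x n) \<noteq> \<zero>\<^bsub>E\<^esub>"
      using cogenerator[OF M N] y(1) x M.M.minus_closed by blast
    then have "(f, f (x n)) \<in> G" by (auto simp: G_def U_def)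
    then have "f y = f (x n)" using y(2) by blast
    then show False
      using f(1,3) x y(1) hom_diff_eq_zero_iff[OF M] by blast
  qed
  then show ?thesis using that y(1) by blast
qed

text \<open>As \<open>h\<close> is onto, precomposition with \<open>h\<close> embeds the dual of
  \<open>Q\<close> into the dual of \<open>M\<close>. A functional on the dual of \<open>Q\<close>
  thus becomes a partial one on the dual of \<open>M\<close>, given by some \<open>x\<close>, and
  \<open>h x\<close> represents the original one.\<close>

lemma reflexive_image:
  assumes refl: "matlis_reflexive R E M" and Q: "module R Q"
    and h: "h \<in> module_hom R M Q" and surj: "h ` carrier M = carrier Q"
  shows "matlis_reflexive R E Q"
proof -
  have M: "module R M" using refl by (simp add: matlis_reflexive_iff)
  interpret M: module R M by fact
  interpret Q: module R Q by fact
  interpret DQ: module R "matlis_dual R E Q" using Q by (rule module_dual)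
  show ?thesis
    unfolding matlis_reflexive_iff
  proof (intro conjI ballI Q)
    fix \<phi> assume \<phi>: "\<phi> \<in> module_hom R (matlis_dual R E Q) E"
    note hom = module_hom_closed[OF \<phi>] module_hom_add[OF \<phi>] module_hom_smult[OF \<phi>]
    note h_closed = module_hom_closed[OF h]
    let ?h = "\<lambda>g. \<lambda>x\<in>carrier M. g (h x)"
    define G where "G = {(?h g, \<phi> g) | g. g \<in> module_hom R Q E}"
    have GI: "(f, e) \<in> G" if "g \<in> module_hom R Q E" "f = ?h g" "e = \<phi> g" for f e g
      using that by (auto simp: G_def)
    have "linear_relation R (matlis_dual R E M) E G"
    proof (rule linear_relationI)
      fix f e assume fe: "(f, e) \<in> G"
      then show "f \<in> carrier (matlis_dual R E M)" "e \<in> carrier E"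
        using h hom M by (auto simp: G_def intro: module_hom_comp)
    next
      show "(\<zero>\<^bsub>matlis_dual R E M\<^esub>, \<zero>\<^bsub>E\<^esub>) \<in> G"
        using DQ.M.zero_closed h_closed module_hom_zero[OF DQ.module_axioms module_axioms \<phi>]
        by (intro GI[of "\<zero>\<^bsub>matlis_dual R E Q\<^esub>"]) (auto cong: restrict_cong)
    next
      fix f e g d assume "(f, e) \<in> G" "(g, d) \<in> G"
      then obtain f' g' where 1: "f' \<in> module_hom R Q E" "g' \<in> module_hom R Q E"
          "f = ?h f'" "g = ?h g'" "e = \<phi> f'" "d = \<phi> g'"
        by (auto simp: G_def)
      show "(f \<oplus>\<^bsub>matlis_dual R E M\<^esub> g, e \<oplus>\<^bsub>E\<^esub> d) \<in> G"
        using 1 DQ.M.a_closed[of f' g'] h_closed hom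
        by (intro GI[of "f' \<oplus>\<^bsub>matlis_dual R E Q\<^esub> g'"]) (auto cong: restrict_cong)
    next
      fix r f e assume r: "r \<in> carrier R" and "(f, e) \<in> G"
      then obtain f' where 1: "f' \<in> module_hom R Q E" "f = ?h f'" "e = \<phi> f'"
        by (auto simp: G_def)
      show "(r \<odot>\<^bsub>matlis_dual R E M\<^esub> f, r \<odot>\<^bsub>E\<^esub> e) \<in> G"
        using 1 r DQ.smult_closed[of r f'] h_closed hom
        by (intro GI[of "r \<odot>\<^bsub>matlis_dual R E Q\<^esub> f'"]) (auto cong: restrict_cong)
    next
      fix e assume "(\<zero>\<^bsub>matlis_dual R E M\<^esub>, e) \<in> G"
      then obtain f where 1: "f \<in> module_hom R Q E" "?h f = (\<lambda>x\<in>carrier M. \<zero>\<^bsub>E\<^esub>)" "e = \<phi> f"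
        by (auto simp: G_def)
      have "f z = \<zero>\<^bsub>E\<^esub>" if z: "z \<in> carrier Q" for z
      proof -
        obtain x where "x \<in> carrier M" "z = h x" using z surj by blast
        then show ?thesis using fun_cong[OF 1(2), of x] by simp
      qed
      then have "f = \<zero>\<^bsub>matlis_dual R E Q\<^esub>"
        using 1(1) DQ.M.zero_closed by (intro module_hom_ext[of _ R Q E]) auto
      then show "e = \<zero>\<^bsub>E\<^esub>"
        using 1 module_hom_zero[OF DQ.module_axioms module_axioms \<phi>] by simp
    qed
    from reflexive_relation[OF refl this] obtain x where x: "x \<in> carrier M" "\<And>f e. (f, e) \<in> G \<Longrightarrow> f x = e"
      by blast
    have "\<phi> f = f (h x)" if "f \<in> module_hom R Q E" for f
      using x(2)[of "?h f" "\<phi> f"] GI[OF that] x(1) by simp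
    then show "\<exists>x\<in>carrier Q. \<forall>f\<in>module_hom R Q E. \<phi> f = f x"
      using h_closed[OF x(1)] by blast
  qed
qed

end


section \<open>Cosets and injective hulls\<close>

lemma (in abelian_subgroup) a_rcos_eq_iff:
  assumes "x \<in> carrier G" "y \<in> carrier G"
  shows "H +> x = H +> y \<longleftrightarrow> x \<ominus> y \<in> H"
proof
  assume "H +> x = H +> y"
  then have "x \<in> H +> y" using a_rcos_self assms by blast
  then obtain h where h: "h \<in> H" "x = h \<oplus> y" by (auto simp: a_r_coset_def')
  then have "x \<ominus> y = h"
    using assms a_Hcarr by (simp add: a_minus_def a_assoc r_neg)
  then show "x \<ominus> y \<in> H" using h by simp
next
  assume "x \<ominus> y \<in> H"
  moreover have "x = (x \<ominus> y) \<oplus> y"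
    using assms by (simp add: a_minus_def a_assoc l_neg)
  ultimately have "x \<in> H +> y" unfolding a_r_coset_def' by blast
  then show "H +> x = H +> y"
    using a_repr_independence[OF _ assms(2)] a_subgroup by blast
qed

text \<open>Evaluates on a representative the transition map of the inverse systems.\<close>

lemma (in abelian_group) a_rcos_add_subgroup:
  assumes H: "additive_subgroup H G" and K: "additive_subgroup K G" and le: "H \<subseteq> K"
    and x: "x \<in> carrier G"
  shows "(H +> x) <+> K = K +> x"
proof -
  interpret H: additive_subgroup H G by fact
  interpret K: additive_subgroup K G by fact
  show ?thesis
  proof (intro equalityI subsetI)
    fix z :: 'a assume "z \<in> (H +> x) <+> K"
    then obtain h k where 1: "h \<in> H" "k \<in> K" "z = h \<oplus> x \<oplus> k"
      by (auto simp: a_r_coset_def' set_add_def')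
    then have "z = (h \<oplus> k) \<oplus> x" "h \<oplus> k \<in> K"
      using x le by (auto simp: a_ac)
    then show "z \<in> K +> x" by (auto simp: a_r_coset_def')
  next
    fix z assume "z \<in> K +> x"
    then obtain k where 1: "k \<in> K" "z = k \<oplus> x" by (auto simp: a_r_coset_def')
    then have "z = \<zero> \<oplus> x \<oplus> k" using x by (simp add: a_comm)
    then show "z \<in> (H +> x) <+> K"
      using 1 H.zero_closed unfolding a_r_coset_def' set_add_def' by blast
  qed
qed

text \<open>A choice of representatives replaces compatible sequences of cosets by sequences of
  elements, on which all later computations take place. Both the completed ring and the completed
  module are instances.\<close>

lemma (in abelian_group) compatible_cosets_iff:
  assumes H: "\<And>n::nat. additive_subgroup (H n) G" and dec: "\<And>k n. k \<le> n \<Longrightarrow> H n \<subseteq> H k"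
  shows "(\<forall>n. X n \<in> a_rcosets (H n)) \<and> (\<forall>k n. k \<le> n \<longrightarrow> X k = X n <+> H k) \<longleftrightarrow>
    (\<exists>x. (\<forall>n. x n \<in> carrier G) \<and> (\<forall>k n. k \<le> n \<longrightarrow> x n \<ominus> x k \<in> H k) \<and> X = (\<lambda>n. H n +> x n))"
    (is "?L \<longleftrightarrow> ?R")
proof -
  have sub: "abelian_subgroup (H n) G" for n
    by (rule abelian_subgroupI3[OF H]) (rule abelian_group_axioms)
  have compat: "H k +> x k = (H n +> x n) <+> H k \<longleftrightarrow> x n \<ominus> x k \<in> H k"
    if "k \<le> n" "\<And>n. x n \<in> carrier G" for k n x
    using abelian_subgroup.a_rcos_eq_iff[OF sub that(2,2)]
    by (subst a_rcos_add_subgroup[OF H H dec[OF that(1)] that(2)]) metis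
  show ?thesis
  proof
    assume L: ?L
    then have "\<exists>x. x \<in> carrier G \<and> X n = H n +> x" for n
      unfolding A_RCOSETS_def' by blast
    then obtain x where x: "\<And>n. x n \<in> carrier G" "\<And>n. X n = H n +> x n" by metis
    then show ?R using L compat by (intro exI[of _ x]) auto
  next
    assume ?R
    then obtain x where "\<And>n. x n \<in> carrier G" "\<And>k n. k \<le> n \<Longrightarrow> x n \<ominus> x k \<in> H k"
      "X = (\<lambda>n. H n +> x n)" by blast
    then show ?L using compat by (auto simp: A_RCOSETS_def')
  qed
qed

lemma (in module) submodule_additive_subgroup: "submodule N R M \<Longrightarrow> additive_subgroup N M"
  by (simp add: additive_subgroup_def submodule_def)

lemma (in module) submodule_abelian_subgroup: "submodule N R M \<Longrightarrow> abelian_subgroup N M"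
  by (rule abelian_subgroupI3[OF submodule_additive_subgroup]) (auto intro: M.abelian_group_axioms)

text \<open>All cosets in the defining union coincide: for \<open>y = h + x\<close> with
  \<open>h\<close> in \<open>N\<close>, the difference \<open>b y - a x\<close> is
  \<open>b h + (b x - a x)\<close>. This covers a single scalar, \<open>A = {r}\<close>, as well as
  a coset of an ideal power.\<close>

lemma (in module) coset_smult_coset:
  assumes N: "submodule N R M" and A: "A \<subseteq> carrier R" "a \<in> A" and x: "x \<in> carrier M"
    and diff: "\<And>b. b \<in> A \<Longrightarrow> b \<odot>\<^bsub>M\<^esub> x \<ominus>\<^bsub>M\<^esub> a \<odot>\<^bsub>M\<^esub> x \<in> N"
  shows "coset_smult M N A (N +>\<^bsub>M\<^esub> x) = N +>\<^bsub>M\<^esub> (a \<odot>\<^bsub>M\<^esub> x)"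
proof -
  interpret N: abelian_subgroup N M using N by (rule submodule_abelian_subgroup)
  have *: "N +>\<^bsub>M\<^esub> (b \<odot>\<^bsub>M\<^esub> y) = N +>\<^bsub>M\<^esub> (a \<odot>\<^bsub>M\<^esub> x)" if b: "b \<in> A" and y: "y \<in> N +>\<^bsub>M\<^esub> x" for b y
  proof -
    obtain h where h: "h \<in> N" "y = h \<oplus>\<^bsub>M\<^esub> x" using y by (auto simp: a_r_coset_def')
    have c: "b \<in> carrier R" "a \<in> carrier R" "h \<in> carrier M" using A b h N.a_Hcarr by auto
    have "b \<odot>\<^bsub>M\<^esub> y \<ominus>\<^bsub>M\<^esub> a \<odot>\<^bsub>M\<^esub> x = b \<odot>\<^bsub>M\<^esub> h \<oplus>\<^bsub>M\<^esub> (b \<odot>\<^bsub>M\<^esub> x \<ominus>\<^bsub>M\<^esub> a \<odot>\<^bsub>M\<^esub> x)"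
      using c x h by (simp add: smult_r_distr a_minus_def M.a_assoc)
    also have "\<dots> \<in> N"
      using diff[OF b] submoduleE(4)[OF N c(1) h(1)] submoduleE(5)[OF N] by blast
    finally show ?thesis
      using c x h by (subst N.a_rcos_eq_iff) auto
  qed
  have "x \<in> N +>\<^bsub>M\<^esub> x" using x by (rule N.a_rcos_self)
  moreover have "coset_smult M N A (N +>\<^bsub>M\<^esub> x)
      = (\<Union>b\<in>A. \<Union>y\<in>N +>\<^bsub>M\<^esub> x. N +>\<^bsub>M\<^esub> (a \<odot>\<^bsub>M\<^esub> x))"
    unfolding coset_smult_def by (intro SUP_cong refl *)
  ultimately show ?thesis using A(2) by auto
qed

section \<open>Baer's criterion and the residue field inside its hull\<close>

lemma module_self_module:
  assumes "cring R"
  shows "module R (self_module R)"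
proof -
  interpret cring R by fact
  show ?thesis
  proof (rule moduleI)
    show "abelian_group (self_module R)"
      by (rule abelian_groupI) (auto simp: self_module_def a_ac intro: l_neg)
  qed (auto simp: self_module_def l_distr r_distr m_assoc is_cring)
qed

lemma self_module_simps [simp]:
  "carrier (self_module R) = carrier R" "\<zero>\<^bsub>self_module R\<^esub> = \<zero>\<^bsub>R\<^esub>"
  "x \<oplus>\<^bsub>self_module R\<^esub> y = x \<oplus>\<^bsub>R\<^esub> y" "x \<odot>\<^bsub>self_module R\<^esub> y = x \<otimes>\<^bsub>R\<^esub> y"
  "N +>\<^bsub>self_module R\<^esub> x = N +>\<^bsub>R\<^esub> x"
  "\<ominus>\<^bsub>self_module R\<^esub> x = \<ominus>\<^bsub>R\<^esub> x"
  by (simp_all add: self_module_def a_r_coset_def' a_inv_def m_inv_def)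

lemma (in cring) submodule_self_module:
  assumes "ideal J R"
  shows "submodule J R (self_module R)"
proof -
  interpret J: ideal J R by fact
  interpret S: module R "self_module R" by (rule module_self_module) (rule is_cring)
  show ?thesis
    by (intro S.submoduleI) (auto simp: J.Icarr J.I_l_closed)
qed

text \<open>The inclusion of an ideal into the ring is a test monomorphism of the permitted type;
  the extension to the ring is determined by its value at 1, which is the required
  \<open>e\<close>.\<close>

lemma injective_module_imp_baer_module:
  assumes inj: "injective_module R E"
  shows "baer_module R E"
proof -
  interpret module R E using inj by (simp add: injective_module_def)
  let ?S = "self_module R"
  interpret S: module R ?S by (rule module_self_module) (rule R.is_cring)
  show ?thesis
  proof
    fix J g
    assume J: "ideal J R" and g: "\<And>a. a \<in> J \<Longrightarrow> g a \<in> carrier E"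
      "\<And>a b. a \<in> J \<Longrightarrow> b \<in> J \<Longrightarrow> g (a \<oplus>\<^bsub>R\<^esub> b) = g a \<oplus>\<^bsub>E\<^esub> g b"
      "\<And>r a. r \<in> carrier R \<Longrightarrow> a \<in> J \<Longrightarrow> g (r \<otimes>\<^bsub>R\<^esub> a) = r \<odot>\<^bsub>E\<^esub> g a"
    interpret J: ideal J R by fact
    let ?J = "?S\<lparr>carrier := J\<rparr>"
    have JS: "module R ?J"
      using submodule.submodule_is_module[OF R.submodule_self_module[OF J]] S.module_axioms .
    have op: "x \<oplus>\<^bsub>?J\<^esub> y = x \<oplus>\<^bsub>R\<^esub> y" "x \<odot>\<^bsub>?J\<^esub> y = x \<otimes>\<^bsub>R\<^esub> y" for x y
      by (simp_all add: self_module_def)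
    have "(\<lambda>x\<in>J. x) \<in> module_hom R ?J ?S"
      by (rule module_homI) (auto simp: op J.Icarr J.I_l_closed)
    moreover have "inj_on (\<lambda>x\<in>J. x) (carrier ?J)"
      by (auto simp: inj_on_def)
    moreover have "restrict g J \<in> module_hom R ?J E"
      by (rule module_homI) (auto simp: op g J.I_l_closed)
    ultimately have "\<exists>h\<in>module_hom R ?S E. \<forall>x\<in>carrier ?J. h ((\<lambda>x\<in>J. x) x) = restrict g J x"
      using inj JS S.module_axioms unfolding injective_module_def by blast
    then obtain h where h: "h \<in> module_hom R ?S E" "\<forall>x\<in>J. h x = g x"
      by auto
    show "\<exists>e\<in>carrier E. \<forall>a\<in>J. g a = a \<odot>\<^bsub>E\<^esub> e"
    proof (intro bexI ballI)
      fix a assume a: "a \<in> J"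
      have "h (a \<odot>\<^bsub>?S\<^esub> \<one>\<^bsub>R\<^esub>) = a \<odot>\<^bsub>E\<^esub> h \<one>\<^bsub>R\<^esub>"
        using a by (intro module_hom_smult[OF h(1)]) (auto simp: J.Icarr)
      then show "g a = a \<odot>\<^bsub>E\<^esub> h \<one>\<^bsub>R\<^esub>" using h(2) a by (simp add: J.Icarr)
    qed (use module_hom_closed[OF h(1)] in auto)
  qed
qed

text \<open>\<open>u\<close> is the image of the residue class of 1. Essentiality gives a nonzero
  multiple of \<open>e\<close> of the form \<open>a u\<close>; then \<open>a\<close> is outside
  \<open>\<nn>\<close>, and dividing by it gives \<open>u\<close>. Locality is expressed through
  units so that the lemma serves both \<open>R\<close> and its completion.\<close>

lemma injective_hull_imp_matlis:
  fixes R (structure)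
  assumes max: "maximalideal \<nn> R" and unit: "\<And>a. a \<in> carrier R \<Longrightarrow> a \<notin> \<nn> \<Longrightarrow> a \<in> Units R"
    and hull: "injective_hull R (residue_field_module R \<nn>) E"
  obtains u where "matlis R E u"
proof -
  let ?K = "residue_field_module R \<nn>"
  have E: "injective_module R E" and K: "module R ?K"
    using hull by (auto simp: injective_hull_def)
  interpret baer_module R E using E by (rule injective_module_imp_baer_module)
  interpret maximalideal \<nn> R by fact
  interpret K: module R ?K by fact
  interpret S: module R "self_module R" by (rule module_self_module) (rule R.is_cring)
  obtain \<iota> where \<iota>: "\<iota> \<in> module_hom R ?K E" "inj_on \<iota> (carrier ?K)"
    and ess: "\<And>N. submodule N R E \<Longrightarrow> N \<noteq> {\<zero>\<^bsub>E\<^esub>} \<Longrightarrow> N \<inter> \<iota> ` carrier ?K \<noteq> {\<zero>\<^bsub>E\<^esub>}"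
    using hull unfolding injective_hull_def by blast
  have carr: "carrier ?K = (\<lambda>a. \<nn> +> a) ` carrier R" and zero: "\<zero>\<^bsub>?K\<^esub> = \<nn>"
    by (auto simp: residue_field_module_def quotient_module_def A_RCOSETS_def')
  have smult: "r \<odot>\<^bsub>?K\<^esub> (\<nn> +> a) = \<nn> +> (r \<otimes> a)" if "r \<in> carrier R" "a \<in> carrier R" for r a
    using S.coset_smult_coset[OF R.submodule_self_module[OF is_ideal], of "{r}" r a] that
    by (simp add: residue_field_module_def quotient_module_def a_minus_def R.r_neg)
  have eq_zero: "\<nn> +> a = \<nn> \<longleftrightarrow> a \<in> \<nn>" if "a \<in> carrier R" for a
    using that a_rcos_const a_rcos_self by blast
  have \<iota>_zero: "\<iota> X = \<zero>\<^bsub>E\<^esub> \<longleftrightarrow> X = \<nn>" if "X \<in> carrier ?K" for X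
    using module_hom_zero[OF K module_axioms \<iota>(1)] zero \<iota>(2) that K.M.zero_closed
    by (metis inj_onD)
  define u where "u = \<iota> (\<nn> +> \<one>)"
  have one: "\<nn> +> \<one> \<in> carrier ?K" by (simp add: carr)
  have \<iota>_coset: "\<iota> (\<nn> +> a) = a \<odot>\<^bsub>E\<^esub> u" if "a \<in> carrier R" for a
    using module_hom_smult[OF \<iota>(1) that one] smult[OF that R.one_closed] that by (simp add: u_def)
  have u: "u \<in> carrier E" unfolding u_def using \<iota>(1) one by (rule module_hom_closed)
  show ?thesis
  proof (rule that, unfold_locales)
    show "u \<in> carrier E" by (rule u)
    show "u \<noteq> \<zero>\<^bsub>E\<^esub>"
      using \<iota>_zero[OF one] eq_zero[of \<one>] one_imp_carrier I_notcarr by (auto simp: u_def)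
    show "r \<odot>\<^bsub>E\<^esub> u = \<zero>\<^bsub>E\<^esub>" if "r \<in> carrier R" "r \<notin> Units R" for r
    proof -
      have "r \<in> \<nn>" using unit that by blast
      then show ?thesis
        using \<iota>_coset[OF that(1)] \<iota>_zero[of \<nn>] eq_zero[OF that(1)] that(1)
        by (metis carr image_eqI)
    qed
    fix e assume e: "e \<in> carrier E" "e \<noteq> \<zero>\<^bsub>E\<^esub>"
    let ?N = "(\<lambda>r. r \<odot>\<^bsub>E\<^esub> e) ` carrier R"
    have N: "submodule ?N R E" using R.oneideal e(1) by (rule submodule_multiples)
    have "e \<in> ?N" using e(1) by (intro image_eqI[of _ _ \<one>]) auto
    then have "?N \<inter> \<iota> ` carrier ?K \<noteq> {\<zero>\<^bsub>E\<^esub>}" using ess[OF N] e(2) by blast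
    \<comment> \<open>Essentiality says that the intersection differs from \<open>{0}\<close>; a
      nonzero element follows because the intersection contains zero.\<close>
    moreover have "\<zero>\<^bsub>E\<^esub> \<in> ?N \<inter> \<iota> ` carrier ?K"
      using submodule_zero[OF N] module_hom_zero[OF K module_axioms \<iota>(1)] K.M.zero_closed
      by (metis IntI image_eqI)
    ultimately obtain z where z: "z \<in> ?N" "z \<in> \<iota> ` carrier ?K" "z \<noteq> \<zero>\<^bsub>E\<^esub>" by blast
    then obtain r where r: "r \<in> carrier R" "z = r \<odot>\<^bsub>E\<^esub> e" by blast
    obtain a where a: "a \<in> carrier R" "z = \<iota> (\<nn> +> a)" using z(2) by (auto simp: carr)
    have "a \<notin> \<nn>"
      using a z(3) \<iota>_zero[of "\<nn> +> a"] eq_zero[OF a(1)] by (auto simp: carr)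
    then have "a \<in> Units R" using unit a(1) by blast
    then have "(inv a \<otimes> r) \<odot>\<^bsub>E\<^esub> e = u"
      using a r e(1) u \<iota>_coset[OF a(1)] by (simp add: smult_assoc1) (simp flip: smult_assoc1)
    then show "\<exists>r\<in>carrier R. r \<odot>\<^bsub>E\<^esub> e = u"
      using \<open>a \<in> Units R\<close> r(1) by blast
  qed
qed

section \<open>Maximal ideals and units of a local ring\<close>

lemma (in ring) exists_maximalideal:
  assumes J: "ideal J R" and proper: "\<one> \<notin> J"
  obtains \<mm> where "maximalideal \<mm> R" "J \<subseteq> \<mm>"
proof -
  define \<A> where "\<A> = {K. ideal K R \<and> J \<subseteq> K \<and> \<one> \<notin> K}"
  have "\<exists>K\<in>\<A>. \<forall>L\<in>\<A>. K \<subseteq> L \<longrightarrow> L = K"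
  proof (rule subset_Zorn_nonempty)
    show "\<A> \<noteq> {}" using assms by (auto simp: \<A>_def)
    fix \<C> assume \<C>: "\<C> \<noteq> {}" "subset.chain \<A> \<C>"
    then have "subset.chain {I. ideal I R} \<C>"
      by (auto simp: subset.chain_def \<A>_def)
    from chain_Union_is_ideal[OF this] \<C>(1) have "ideal (\<Union>\<C>) R" by simp
    then show "\<Union>\<C> \<in> \<A>" using \<C> by (auto simp: subset.chain_def \<A>_def)
  qed
  then obtain K where K: "K \<in> \<A>" and max: "\<And>L. L \<in> \<A> \<Longrightarrow> K \<subseteq> L \<Longrightarrow> L = K" by blast
  have "maximalideal K R"
  proof (rule maximalidealI)
    show "ideal K R" using K by (simp add: \<A>_def)
    show "carrier R \<noteq> K" using K one_closed by (auto simp: \<A>_def)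
    fix L assume L: "ideal L R" "K \<subseteq> L"
    show "L = K \<or> L = carrier R"
    proof (cases "\<one> \<in> L")
      case False
      then have "L \<in> \<A>" using L K by (auto simp: \<A>_def)
      then show ?thesis using max L(2) by blast
    qed (use ideal.one_imp_carrier[OF L(1)] in blast)
  qed
  then show ?thesis using that K by (auto simp: \<A>_def)
qed

text \<open>A nonunit generates a proper ideal, and the maximal ideal above it can only be
  \<open>\<mm>\<close>.\<close>

lemma local_noetherian_ring_Units:
  fixes R (structure)
  assumes loc: "local_noetherian_ring R \<mm>" and a: "a \<in> carrier R" "a \<notin> \<mm>"
  shows "a \<in> Units R"
proof (rule ccontr)
  interpret cring R using loc by (simp add: local_noetherian_ring_def)
  assume nonunit: "a \<notin> Units R"
  have "\<one> \<notin> PIdl a"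
  proof
    assume "\<one> \<in> PIdl a"
    then obtain b where "b \<in> carrier R" "\<one> = b \<otimes> a" by (auto simp: cgenideal_def)
    then show False using a nonunit unit_factor m_comm by (metis Units_one_closed)
  qed
  then obtain \<nn> where "maximalideal \<nn> R" "PIdl a \<subseteq> \<nn>"
    using exists_maximalideal cgenideal_ideal[OF a(1)] by blast
  then show False
    using loc a cgenideal_self[OF a(1)] by (auto simp: local_noetherian_ring_def)
qed


section \<open>Change of rings\<close>

text \<open>\<open>N'\<close> is an arbitrary record agreeing with \<open>N\<close>, so that the
  lemma applies to \<open>restrict_scalars\<close> and also to \<open>completion\<close>, whose
  scalar action is defined independently of \<open>completion_hat\<close>.\<close>

lemma module_pullback:
  assumes R: "cring R" and \<phi>: "\<phi> \<in> ring_hom R S" and N: "module S N"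
    and N': "carrier N' = carrier N" "\<zero>\<^bsub>N'\<^esub> = \<zero>\<^bsub>N\<^esub>" "add N' = add N"
      "\<And>r x. r \<in> carrier R \<Longrightarrow> x \<in> carrier N \<Longrightarrow> r \<odot>\<^bsub>N'\<^esub> x = \<phi> r \<odot>\<^bsub>N\<^esub> x"
  shows "module R N'"
proof -
  interpret N: module S N by fact
  interpret R: cring R by fact
  note h = ring_hom_closed[OF \<phi>] ring_hom_add[OF \<phi>] ring_hom_mult[OF \<phi>] ring_hom_one[OF \<phi>]
  show ?thesis
  proof (rule moduleI)
    show "abelian_group N'"
      by (rule abelian_groupI) (auto simp: N' N.M.a_ac intro: N.M.l_neg)
  qed (auto simp: N' h R N.smult_l_distr N.smult_r_distr N.smult_assoc1)
qed

definition restrict_scalars ::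
  "('a \<Rightarrow> 's) \<Rightarrow> ('s, 'b, 'm) module_scheme \<Rightarrow> ('a, 'b) module" where
  "restrict_scalars \<phi> N =
     \<lparr>carrier = carrier N, monoid.mult = undefined, one = undefined, zero = \<zero>\<^bsub>N\<^esub>, add = add N,
      smult = (\<lambda>r. smult N (\<phi> r))\<rparr>"

lemma restrict_scalars_simps [simp]:
  "carrier (restrict_scalars \<phi> N) = carrier N" "\<zero>\<^bsub>restrict_scalars \<phi> N\<^esub> = \<zero>\<^bsub>N\<^esub>"
  "add (restrict_scalars \<phi> N) = add N" "r \<odot>\<^bsub>restrict_scalars \<phi> N\<^esub> x = \<phi> r \<odot>\<^bsub>N\<^esub> x"
  by (simp_all add: restrict_scalars_def)

lemma module_restrict_scalars:
  assumes "cring R" "\<phi> \<in> ring_hom R S" "module S N"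
  shows "module R (restrict_scalars \<phi> N)"
  by (rule module_pullback[OF assms]) simp_all

text \<open>
  The linear map \<open>p\<close> with \<open>p u' = u\<close> in the proof need not be injective on \<open>E'\<close>, but it is so on elements whose
  \<open>S\<close>-multiples are \<open>R\<close>-multiples.  By \<open>scalars\<close> and reflexivity, this suffices to
  embed the \<open>S\<close>-dual of \<open>Q'\<close> into the \<open>R\<close>-dual of \<open>Q\<close>.
\<close>

theorem matlis_reflexive_change_of_rings:
  assumes E: "matlis R E u" and E': "matlis S E' u'" and \<phi>: "\<phi> \<in> ring_hom R S"
    and refl: "matlis_reflexive R E Q" and Q': "module S Q'"
    and same: "carrier Q' = carrier Q" "\<zero>\<^bsub>Q'\<^esub> = \<zero>\<^bsub>Q\<^esub>" "add Q' = add Q"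
    and smult: "\<And>r x. r \<in> carrier R \<Longrightarrow> x \<in> carrier Q \<Longrightarrow> r \<odot>\<^bsub>Q\<^esub> x = \<phi> r \<odot>\<^bsub>Q'\<^esub> x"
    and scalars: "\<And>s x. s \<in> carrier S \<Longrightarrow> x \<in> carrier Q \<Longrightarrow>
      \<exists>r\<in>carrier R. s \<odot>\<^bsub>Q'\<^esub> x = \<phi> r \<odot>\<^bsub>Q'\<^esub> x"
  shows "matlis_reflexive S E' Q'"
proof -
  interpret ER: matlis R E u by fact
  interpret ES: matlis S E' u' by fact
  interpret Q': module S Q' by fact
  have Q: "module R Q" using refl by (simp add: ER.matlis_reflexive_iff)
  interpret Q: module R Q by fact
  let ?E = "restrict_scalars \<phi> E'"
  have E'R: "module R ?E"
    by (rule module_restrict_scalars[OF ER.R.is_cring \<phi> ES.module_axioms])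
  interpret E'R: module R ?E by fact
  let ?D = "matlis_dual R E Q" and ?D' = "matlis_dual S E' Q'"
  interpret D: module R ?D using Q by (rule ER.module_dual)
  interpret D': module S ?D' using Q' by (rule ES.module_dual)
  note h = ring_hom_closed[OF \<phi>] ring_hom_add[OF \<phi>] ring_hom_mult[OF \<phi>] ring_hom_one[OF \<phi>]

  \<comment> \<open>Makes \<open>G0\<close> single valued: \<open>\<phi> r u' = 0\<close> forces
    \<open>r\<close> to be a nonunit, and then \<open>r u = 0\<close>.\<close>
  have unit: "\<phi> r \<odot>\<^bsub>E'\<^esub> u' \<noteq> \<zero>\<^bsub>E'\<^esub>" if r: "r \<in> Units R" for r
  proof
    assume 0: "\<phi> r \<odot>\<^bsub>E'\<^esub> u' = \<zero>\<^bsub>E'\<^esub>"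
    have "u' = \<phi> (inv\<^bsub>R\<^esub> r \<otimes>\<^bsub>R\<^esub> r) \<odot>\<^bsub>E'\<^esub> u'"
      using r h(4) ES.u_carrier by simp
    also have "\<dots> = \<phi> (inv\<^bsub>R\<^esub> r) \<odot>\<^bsub>E'\<^esub> (\<phi> r \<odot>\<^bsub>E'\<^esub> u')"
      using r h(1,3) ES.u_carrier ER.R.Units_closed ER.R.Units_inv_closed
      by (simp add: ES.smult_assoc1 del: ER.R.Units_l_inv)
    finally show False using 0 r h(1) ES.u_nonzero by simp
  qed
  \<comment> \<open>The partial map from the \<open>R\<close>-multiples of \<open>u'\<close> to
    those of \<open>u\<close> that sends \<open>u'\<close> to \<open>u\<close>; injectivity of
    \<open>E\<close> over \<open>R\<close> extends it to \<open>p\<close>.\<close>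
  define G0 where "G0 = {(\<phi> r \<odot>\<^bsub>E'\<^esub> u', r \<odot>\<^bsub>E\<^esub> u) | r. r \<in> carrier R}"
  have G0I: "(x, e) \<in> G0" if "r \<in> carrier R" "x = \<phi> r \<odot>\<^bsub>E'\<^esub> u'" "e = r \<odot>\<^bsub>E\<^esub> u" for x e r
    using that by (auto simp: G0_def)
  have "linear_relation R ?E E G0"
  proof (rule linear_relationI)
    have "\<phi> \<zero>\<^bsub>R\<^esub> \<odot>\<^bsub>E'\<^esub> u' = \<zero>\<^bsub>E'\<^esub>"
      using E'R.smult_l_null[of u'] ES.u_carrier by simp
    then show "(\<zero>\<^bsub>?E\<^esub>, \<zero>\<^bsub>E\<^esub>) \<in> G0"
      using ER.u_carrier by (intro G0I[of "\<zero>\<^bsub>R\<^esub>"]) auto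
    show "(x \<oplus>\<^bsub>?E\<^esub> y, e \<oplus>\<^bsub>E\<^esub> d) \<in> G0" if xy: "(x, e) \<in> G0" "(y, d) \<in> G0" for x e y d
    proof -
      obtain r s where "r \<in> carrier R" "x = \<phi> r \<odot>\<^bsub>E'\<^esub> u'" "e = r \<odot>\<^bsub>E\<^esub> u"
          "s \<in> carrier R" "y = \<phi> s \<odot>\<^bsub>E'\<^esub> u'" "d = s \<odot>\<^bsub>E\<^esub> u"
        using xy unfolding G0_def by blast
      then show ?thesis
        using ER.u_carrier ES.u_carrier
        by (intro G0I[of "r \<oplus>\<^bsub>R\<^esub> s"]) (auto simp: h ER.smult_l_distr ES.smult_l_distr)
    qed
    show "(r \<odot>\<^bsub>?E\<^esub> x, r \<odot>\<^bsub>E\<^esub> e) \<in> G0" if r: "r \<in> carrier R" and x: "(x, e) \<in> G0" for r x e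
    proof -
      obtain s where "s \<in> carrier R" "x = \<phi> s \<odot>\<^bsub>E'\<^esub> u'" "e = s \<odot>\<^bsub>E\<^esub> u"
        using x unfolding G0_def by blast
      then show ?thesis
        using r ER.u_carrier ES.u_carrier
        by (intro G0I[of "r \<otimes>\<^bsub>R\<^esub> s"]) (auto simp: h ER.smult_assoc1 ES.smult_assoc1)
    qed
    show "e = \<zero>\<^bsub>E\<^esub>" if e: "(\<zero>\<^bsub>?E\<^esub>, e) \<in> G0" for e
    proof -
      obtain r where "r \<in> carrier R" "\<zero>\<^bsub>E'\<^esub> = \<phi> r \<odot>\<^bsub>E'\<^esub> u'" "e = r \<odot>\<^bsub>E\<^esub> u"
        using e unfolding G0_def by auto
      then show ?thesis using unit[of r] ER.nonunit_smult_u by auto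
    qed
  qed (use ER.u_carrier ES.u_carrier h(1) in \<open>auto simp: G0_def\<close>)
  from ER.extend_relation[OF E'R this] obtain p where p: "p \<in> module_hom R ?E E"
    and pG: "\<forall>(x, e)\<in>G0. p x = e" by blast
  have pu: "p u' = u"
    using pG G0I[of "\<one>\<^bsub>R\<^esub>" u' u] h(4) ER.u_carrier ES.u_carrier by auto
  note p_closed = module_hom_closed[OF p, simplified]
  note p_add = module_hom_add[OF p, simplified]
  note p_smult = module_hom_smult[OF p, simplified]
  have p_zero: "p \<zero>\<^bsub>E'\<^esub> = \<zero>\<^bsub>E\<^esub>"
    using module_hom_zero[OF E'R ER.module_axioms p] by simp

  \<comment> \<open>A nonzero \<open>e\<close> has \<open>u'\<close> among its
    \<open>S\<close>-multiples, hence by \<open>mult\<close> among its \<open>R\<close>-multiples;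
    applying \<open>p\<close> exhibits \<open>u\<close> as a multiple of \<open>p e\<close>, which
    is absurd for \<open>p e = 0\<close>.\<close>
  have p_detects: "e = \<zero>\<^bsub>E'\<^esub>"
    if e: "e \<in> carrier E'" "p e = \<zero>\<^bsub>E\<^esub>"
      and mult: "\<And>s. s \<in> carrier S \<Longrightarrow> \<exists>r\<in>carrier R. s \<odot>\<^bsub>E'\<^esub> e = \<phi> r \<odot>\<^bsub>E'\<^esub> e" for e
  proof (rule ccontr)
    assume "e \<noteq> \<zero>\<^bsub>E'\<^esub>"
    then obtain s where "s \<in> carrier S" "s \<odot>\<^bsub>E'\<^esub> e = u'" using ES.essential e(1) by blast
    with mult obtain r where r: "r \<in> carrier R" "\<phi> r \<odot>\<^bsub>E'\<^esub> e = u'" by metis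
    then have "u = r \<odot>\<^bsub>E\<^esub> p e" using p_smult[OF r(1) e(1)] pu by simp
    then show False using e(2) r(1) ER.u_nonzero by simp
  qed
  \<comment> \<open>The value \<open>f x\<close> inherits the scalar property from \<open>x\<close>,
    because \<open>f\<close> is \<open>S\<close>-linear.\<close>
  have p_inj: "f x = \<zero>\<^bsub>E'\<^esub>"
    if f: "f \<in> module_hom S Q' E'" and x: "x \<in> carrier Q" and 0: "p (f x) = \<zero>\<^bsub>E\<^esub>" for f x
  proof (rule p_detects)
    show "f x \<in> carrier E'" using module_hom_closed[OF f] x same(1) by simp
    fix s assume s: "s \<in> carrier S"
    with scalars x obtain r where "r \<in> carrier R" "s \<odot>\<^bsub>Q'\<^esub> x = \<phi> r \<odot>\<^bsub>Q'\<^esub> x" by blast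
    moreover have "f (t \<odot>\<^bsub>Q'\<^esub> x) = t \<odot>\<^bsub>E'\<^esub> f x" if "t \<in> carrier S" for t
      using module_hom_smult[OF f that] x same(1) by simp
    ultimately show "\<exists>r\<in>carrier R. s \<odot>\<^bsub>E'\<^esub> f x = \<phi> r \<odot>\<^bsub>E'\<^esub> f x" using s h(1) by metis
  qed (rule 0)

  have Q'_smult_closed: "t \<odot>\<^bsub>Q'\<^esub> x \<in> carrier Q" if "t \<in> carrier S" "x \<in> carrier Q" for t x
    using Q'.smult_closed[of t x] that same(1) by simp
  define P where "P f = (\<lambda>x\<in>carrier Q. p (f x))" for f
  have P: "P f \<in> module_hom R Q E" if f: "f \<in> module_hom S Q' E'" for f
    using module_hom_closed[OF f] module_hom_add[OF f] module_hom_smult[OF f] h(1)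
    unfolding P_def
    by (intro module_homI) (auto simp: same p_closed p_add p_smult smult Q'_smult_closed)
  \<comment> \<open>The factor \<open>r\<close> supplied by \<open>scalars\<close> may depend on
    \<open>x\<close>. One \<open>r\<close> for all \<open>x\<close> is required, since
    \<open>\<psi>\<close> is applied to \<open>f\<close> as a whole.\<close>
  have dual_scalars: "\<exists>r\<in>carrier R. \<forall>x\<in>carrier Q. s \<odot>\<^bsub>E'\<^esub> f x = \<phi> r \<odot>\<^bsub>E'\<^esub> f x"
    if s: "s \<in> carrier S" and f: "f \<in> module_hom S Q' E'" for s f
  proof -
    let ?sf = "s \<odot>\<^bsub>?D'\<^esub> f"
    have sf: "?sf \<in> module_hom S Q' E'" using D'.smult_closed[of s f] s f by simp
    have f_closed: "f x \<in> carrier E'" if "x \<in> carrier Q" for x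
      using module_hom_closed[OF f] that same(1) by simp
    have f_smult: "f (t \<odot>\<^bsub>Q'\<^esub> x) = t \<odot>\<^bsub>E'\<^esub> f x" if "t \<in> carrier S" "x \<in> carrier Q" for t x
      using module_hom_smult[OF f] that same(1) by simp
    \<comment> \<open>Otherwise a functional separates \<open>P (s f)\<close> from the multiples of
      \<open>P f\<close>. By reflexivity it is evaluation at some \<open>x\<close>; there
      \<open>P f\<close> vanishes, hence so does \<open>f\<close> by \<open>p_inj\<close>, and with
      it \<open>s f\<close>.\<close>
    have "P ?sf \<in> (\<lambda>r. r \<odot>\<^bsub>?D\<^esub> P f) ` carrier R"
    proof (rule ccontr)
      assume contra: "\<not> ?thesis"
      have "submodule ((\<lambda>r. r \<odot>\<^bsub>?D\<^esub> P f) ` carrier R) R ?D"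
        using P[OF f] ER.R.oneideal by (intro D.submodule_multiples) auto
      with contra obtain F where F: "F \<in> module_hom R ?D E"
          "\<And>g. g \<in> (\<lambda>r. r \<odot>\<^bsub>?D\<^esub> P f) ` carrier R \<Longrightarrow> F g = \<zero>\<^bsub>E\<^esub>" "F (P ?sf) \<noteq> \<zero>\<^bsub>E\<^esub>"
        using ER.cogenerator[OF D.module_axioms _ _ contra] P[OF sf] by (metis Hom_module_simps(1))
      obtain x where x: "x \<in> carrier Q" "\<And>g. g \<in> module_hom R Q E \<Longrightarrow> F g = g x"
        using refl F(1) unfolding ER.matlis_reflexive_iff by blast
      have "P f \<in> (\<lambda>r. r \<odot>\<^bsub>?D\<^esub> P f) ` carrier R"
        using D.smult_one[of "P f"] P[OF f] by (metis Hom_module_simps(1) ER.R.one_closed image_eqI)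
      then have "P f x = \<zero>\<^bsub>E\<^esub>" using F(2) x(2)[OF P[OF f]] by simp
      then have "f x = \<zero>\<^bsub>E'\<^esub>" using p_inj[OF f x(1)] x(1) by (simp add: P_def)
      then have "P ?sf x = \<zero>\<^bsub>E\<^esub>"
        using x(1) s by (simp add: P_def same p_zero)
      then show False using F(3) x(2)[OF P[OF sf]] by simp
    qed
    then obtain r where r: "r \<in> carrier R" "P ?sf = r \<odot>\<^bsub>?D\<^esub> P f" by blast
    have "s \<odot>\<^bsub>E'\<^esub> f x = \<phi> r \<odot>\<^bsub>E'\<^esub> f x" if x: "x \<in> carrier Q" for x
    proof -
      obtain t where t: "t \<in> carrier R" "s \<odot>\<^bsub>Q'\<^esub> x = \<phi> t \<odot>\<^bsub>Q'\<^esub> x" using scalars[OF s x] by blast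
      \<comment> \<open>The equality holds only after applying \<open>p\<close>. Moving both scalars
        inside \<open>f\<close> turns the difference into a value \<open>f z\<close> with
        \<open>z\<close> in \<open>Q\<close>, and on such values \<open>p\<close> detects
        zero.\<close>
      have "p (s \<odot>\<^bsub>E'\<^esub> f x) = p (\<phi> r \<odot>\<^bsub>E'\<^esub> f x)"
        using fun_cong[OF r(2), of x] x r(1) f_closed by (simp add: P_def same p_smult)
      then have eq: "p (f (\<phi> t \<odot>\<^bsub>Q'\<^esub> x)) = p (f (\<phi> r \<odot>\<^bsub>Q'\<^esub> x))"
        using t s x h(1) r(1) by (metis f_smult)
      have c: "\<phi> t \<odot>\<^bsub>Q'\<^esub> x \<in> carrier Q'" "\<phi> r \<odot>\<^bsub>Q'\<^esub> x \<in> carrier Q'"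
        using t r x same(1) h(1) by auto
      define z where "z = \<phi> t \<odot>\<^bsub>Q'\<^esub> x \<ominus>\<^bsub>Q'\<^esub> \<phi> r \<odot>\<^bsub>Q'\<^esub> x"
      have z: "z \<in> carrier Q" using Q'.M.minus_closed[OF c] same(1) by (simp add: z_def)
      have fz: "f z = f (\<phi> t \<odot>\<^bsub>Q'\<^esub> x) \<ominus>\<^bsub>E'\<^esub> f (\<phi> r \<odot>\<^bsub>Q'\<^esub> x)"
        unfolding z_def using c by (rule module_hom_minus[OF Q' ES.module_axioms f])
      have minus: "a \<ominus>\<^bsub>?E\<^esub> b = a \<ominus>\<^bsub>E'\<^esub> b" for a b
        by (simp add: a_minus_def a_inv_def m_inv_def)
      have "p (f z) = \<zero>\<^bsub>E\<^esub>"
        using ER.hom_diff_eq_zero_iff[OF E'R p, of "f (\<phi> t \<odot>\<^bsub>Q'\<^esub> x)" "f (\<phi> r \<odot>\<^bsub>Q'\<^esub> x)"]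
          eq c module_hom_closed[OF f] by (simp add: fz minus)
      then have "f z = \<zero>\<^bsub>E'\<^esub>" by (rule p_inj[OF f z])
      then have "f (\<phi> t \<odot>\<^bsub>Q'\<^esub> x) = f (\<phi> r \<odot>\<^bsub>Q'\<^esub> x)"
        using ES.hom_diff_eq_zero_iff[OF Q' f c] by (simp add: z_def)
      then show ?thesis using t s x h(1) r(1) by (metis f_smult)
    qed
    then show ?thesis using r(1) by blast
  qed

  show ?thesis
    unfolding ES.matlis_reflexive_iff
  proof (intro conjI ballI Q')
    fix \<psi> assume \<psi>: "\<psi> \<in> module_hom S ?D' E'"
    note \<psi>_hom = module_hom_closed[OF \<psi>] module_hom_add[OF \<psi>] module_hom_smult[OF \<psi>]
    have \<psi>_zero: "\<psi> \<zero>\<^bsub>?D'\<^esub> = \<zero>\<^bsub>E'\<^esub>"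
      by (rule module_hom_zero[OF D'.module_axioms ES.module_axioms \<psi>])
    \<comment> \<open>Transports \<open>\<psi>\<close> along \<open>P\<close> to a partial
      functional on the \<open>R\<close>-dual of \<open>Q\<close>. The fibre over zero is trivial
      because \<open>p_inj\<close> makes \<open>P\<close> injective.\<close>
    define G where "G = {(P f, p (\<psi> f)) | f. f \<in> module_hom S Q' E'}"
    have GI: "(g, e) \<in> G" if "f \<in> module_hom S Q' E'" "g = P f" "e = p (\<psi> f)" for f g e
      using that by (auto simp: G_def)
    have "linear_relation R ?D E G"
    proof (rule linear_relationI)
      show "(\<zero>\<^bsub>?D\<^esub>, \<zero>\<^bsub>E\<^esub>) \<in> G"
        using D'.M.zero_closed \<psi>_zero p_zero
        by (intro GI[of "\<zero>\<^bsub>?D'\<^esub>"]) (auto simp: P_def same)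
      show "(f \<oplus>\<^bsub>?D\<^esub> g, e \<oplus>\<^bsub>E\<^esub> d) \<in> G" if fg: "(f, e) \<in> G" "(g, d) \<in> G" for f e g d
      proof -
        obtain f' g' where 1: "f' \<in> module_hom S Q' E'" "g' \<in> module_hom S Q' E'"
            "f = P f'" "g = P g'" "e = p (\<psi> f')" "d = p (\<psi> g')"
          using fg by (auto simp: G_def)
        have "P f' \<oplus>\<^bsub>?D\<^esub> P g' = P (f' \<oplus>\<^bsub>?D'\<^esub> g')"
          using module_hom_closed[OF 1(1)] module_hom_closed[OF 1(2)]
          by (auto simp: P_def same p_add)
        moreover have "p (\<psi> f') \<oplus>\<^bsub>E\<^esub> p (\<psi> g') = p (\<psi> (f' \<oplus>\<^bsub>?D'\<^esub> g'))"
          using 1(1,2) \<psi>_hom(1) \<psi>_hom(2)[of f' g'] by (simp add: p_add)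
        moreover have "f' \<oplus>\<^bsub>?D'\<^esub> g' \<in> module_hom S Q' E'"
          using D'.M.a_closed[of f' g'] 1(1,2) by simp
        ultimately show ?thesis using 1 GI by blast
      qed
      show "(r \<odot>\<^bsub>?D\<^esub> f, r \<odot>\<^bsub>E\<^esub> e) \<in> G" if r: "r \<in> carrier R" and f: "(f, e) \<in> G" for r f e
      proof -
        obtain f' where 1: "f' \<in> module_hom S Q' E'" "f = P f'" "e = p (\<psi> f')"
          using f by (auto simp: G_def)
        have "r \<odot>\<^bsub>?D\<^esub> P f' = P (\<phi> r \<odot>\<^bsub>?D'\<^esub> f')"
          using module_hom_closed[OF 1(1)] r by (auto simp: P_def same p_smult)
        moreover have "r \<odot>\<^bsub>E\<^esub> p (\<psi> f') = p (\<psi> (\<phi> r \<odot>\<^bsub>?D'\<^esub> f'))"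
          using 1(1) r h(1) \<psi>_hom(1) \<psi>_hom(3)[of "\<phi> r" f'] by (simp add: p_smult)
        moreover have "\<phi> r \<odot>\<^bsub>?D'\<^esub> f' \<in> module_hom S Q' E'"
          using D'.smult_closed[of "\<phi> r" f'] 1(1) r h(1) by simp
        ultimately show ?thesis using 1 GI by blast
      qed
      show "e = \<zero>\<^bsub>E\<^esub>" if e: "(\<zero>\<^bsub>?D\<^esub>, e) \<in> G" for e
      proof -
        obtain f where 1: "f \<in> module_hom S Q' E'" "P f = (\<lambda>x\<in>carrier Q. \<zero>\<^bsub>E\<^esub>)" "e = p (\<psi> f)"
          using e by (auto simp: G_def)
        have "f x = \<zero>\<^bsub>E'\<^esub>" if "x \<in> carrier Q" for x
          using fun_cong[OF 1(2), of x] that by (intro p_inj[OF 1(1)]) (auto simp: P_def)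
        then have "f = \<zero>\<^bsub>?D'\<^esub>"
          using 1(1) D'.M.zero_closed by (intro module_hom_ext[of _ S Q' E']) (auto simp: same)
        then show ?thesis using 1(3) \<psi>_zero p_zero by simp
      qed
    qed (use P \<psi>_hom(1) p_closed in \<open>auto simp: G_def\<close>)
    from ER.reflexive_relation[OF refl this] obtain x where x: "x \<in> carrier Q"
      and ev: "\<And>g e. (g, e) \<in> G \<Longrightarrow> g x = e" by blast
    have "\<psi> f = f x" if f: "f \<in> module_hom S Q' E'" for f
    proof -
      have \<psi>f: "\<psi> f \<in> carrier E'" "f x \<in> carrier E'"
        using \<psi>_hom(1) f module_hom_closed[OF f] x same(1) by auto
      have eq: "p (f x) = p (\<psi> f)"
        using ev[of "P f" "p (\<psi> f)"] GI[OF f] x by (simp add: P_def)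
      have minus: "a \<ominus>\<^bsub>?E\<^esub> b = a \<ominus>\<^bsub>E'\<^esub> b" for a b
        by (simp add: a_minus_def a_inv_def m_inv_def)
      \<comment> \<open>So far only the images under \<open>p\<close> agree. The scalar
        \<open>r\<close> from \<open>dual_scalars\<close> replaces \<open>s\<close> on
        \<open>f x\<close> and on \<open>\<psi> f\<close> alike, so it does so on their difference,
        and \<open>p_detects\<close> applies.\<close>
      have "\<psi> f \<ominus>\<^bsub>E'\<^esub> f x = \<zero>\<^bsub>E'\<^esub>"
      proof (rule p_detects)
        show "p (\<psi> f \<ominus>\<^bsub>E'\<^esub> f x) = \<zero>\<^bsub>E\<^esub>"
          using ER.hom_diff_eq_zero_iff[OF E'R p, of "\<psi> f" "f x"] \<psi>f eq by (simp add: minus)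
        fix s assume s: "s \<in> carrier S"
        obtain r where r: "r \<in> carrier R" "\<forall>x\<in>carrier Q. s \<odot>\<^bsub>E'\<^esub> f x = \<phi> r \<odot>\<^bsub>E'\<^esub> f x"
          using dual_scalars[OF s f] by blast
        then have "s \<odot>\<^bsub>?D'\<^esub> f = \<phi> r \<odot>\<^bsub>?D'\<^esub> f"
          by (auto simp: same intro!: restrict_ext)
        then have "s \<odot>\<^bsub>E'\<^esub> \<psi> f = \<phi> r \<odot>\<^bsub>E'\<^esub> \<psi> f"
          using \<psi>_hom(3) s f r(1) h(1) by (metis Hom_module_simps(1))
        moreover have "t \<odot>\<^bsub>E'\<^esub> (\<psi> f \<ominus>\<^bsub>E'\<^esub> f x) = t \<odot>\<^bsub>E'\<^esub> \<psi> f \<ominus>\<^bsub>E'\<^esub> t \<odot>\<^bsub>E'\<^esub> f x"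
          if "t \<in> carrier S" for t
          using \<psi>f that by (simp add: a_minus_def ES.smult_r_distr ES.smult_r_minus)
        ultimately show "\<exists>r\<in>carrier R.
            s \<odot>\<^bsub>E'\<^esub> (\<psi> f \<ominus>\<^bsub>E'\<^esub> f x) = \<phi> r \<odot>\<^bsub>E'\<^esub> (\<psi> f \<ominus>\<^bsub>E'\<^esub> f x)"
          using r s x h(1) by (intro bexI[of _ r]) auto
      qed (use \<psi>f in auto)
      then show ?thesis using \<psi>f by (simp add: ES.M.diff_eq_zero_iff)
    qed
    then show "\<exists>x\<in>carrier Q'. \<forall>f\<in>module_hom S Q' E'. \<psi> f = f x"
      using x same(1) by auto
  qed
qed


section \<open>Adic completions\<close>

text \<open>The product rule for differences, by which a product of Cauchy sequences is
  Cauchy.\<close>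

lemma (in module) smult_diff:
  assumes "a \<in> carrier R" "b \<in> carrier R" "x \<in> carrier M" "y \<in> carrier M"
  shows "a \<odot>\<^bsub>M\<^esub> x \<ominus>\<^bsub>M\<^esub> b \<odot>\<^bsub>M\<^esub> y = a \<odot>\<^bsub>M\<^esub> (x \<ominus>\<^bsub>M\<^esub> y) \<oplus>\<^bsub>M\<^esub> (a \<ominus> b) \<odot>\<^bsub>M\<^esub> y"
proof -
  have "a \<odot>\<^bsub>M\<^esub> (x \<ominus>\<^bsub>M\<^esub> y) \<oplus>\<^bsub>M\<^esub> (a \<ominus> b) \<odot>\<^bsub>M\<^esub> y
      = a \<odot>\<^bsub>M\<^esub> x \<oplus>\<^bsub>M\<^esub> (\<ominus>\<^bsub>M\<^esub> (a \<odot>\<^bsub>M\<^esub> y) \<oplus>\<^bsub>M\<^esub> a \<odot>\<^bsub>M\<^esub> y) \<oplus>\<^bsub>M\<^esub> \<ominus>\<^bsub>M\<^esub> (b \<odot>\<^bsub>M\<^esub> y)"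
    using assms
    by (simp add: a_minus_def smult_r_distr smult_l_distr smult_r_minus smult_l_minus M.a_assoc)
  then show ?thesis using assms by (simp add: M.l_neg a_minus_def)
qed

lemma (in abelian_group) add_diff_add:
  assumes "x \<in> carrier G" "y \<in> carrier G" "x' \<in> carrier G" "y' \<in> carrier G"
  shows "(x \<oplus> y) \<ominus> (x' \<oplus> y') = (x \<ominus> x') \<oplus> (y \<ominus> y')"
  using assms by (simp add: a_minus_def minus_add a_ac)

section \<open>The completed ring through sequences of representatives\<close>

locale adic_ring = cring R for R (structure) +
  fixes I
  assumes I_ideal: "ideal I R"
begin

abbreviation "P n \<equiv> ideal_power R I n"

abbreviation "S \<equiv> completion_ring R I"

lemma ideal_power_Suc: "P (Suc n) = P n \<cdot> I"
  by (simp add: ideals_set_def)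

lemma ideal_power_ideal: "ideal (P n) R"
proof (induction n)
  case 0
  then show ?case using oneideal by (simp add: ideals_set_def)
next
  case (Suc n)
  then show ?case unfolding ideal_power_Suc using I_ideal by (rule ideal_prod_is_ideal)
qed

lemma ideal_power_0: "P 0 = carrier R"
  by (simp add: ideals_set_def)

lemma ideal_power_antimono: "k \<le> n \<Longrightarrow> P n \<subseteq> P k"
proof (induction n rule: dec_induct)
  case (step n)
  then show ?case
    using ideal_prod_inter[OF ideal_power_ideal I_ideal] unfolding ideal_power_Suc by blast
qed simp

lemma ideal_power_Suc_subset: "P (Suc n) \<subseteq> I"
  using ideal_prod_inter[OF ideal_power_ideal I_ideal] unfolding ideal_power_Suc by blast

lemma ideal_power_additive_subgroup: "additive_subgroup (P n) R"
  using ideal_power_ideal by (rule ideal.axioms(1))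

lemma ideal_power_abelian_subgroup: "abelian_subgroup (P n) R"
  by (rule abelian_subgroupI3[OF ideal_power_additive_subgroup]) (rule abelian_group_axioms)

text \<open>The modulus is fixed: all terms from index \<open>k\<close> on agree modulo
  \<open>I^k\<close>. Thus the cosets of the terms are compatible as they stand, and equality of
  limits can be tested termwise.\<close>

definition cauchy :: "(nat \<Rightarrow> 'a) \<Rightarrow> bool" where
  "cauchy a \<longleftrightarrow> (\<forall>n. a n \<in> carrier R) \<and> (\<forall>k n. k \<le> n \<longrightarrow> a n \<ominus> a k \<in> P k)"

definition rlim :: "(nat \<Rightarrow> 'a) \<Rightarrow> nat \<Rightarrow> 'a set" where
  "rlim a = (\<lambda>n. P n +> a n)"

lemma cauchy_closed: "cauchy a \<Longrightarrow> a n \<in> carrier R"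
  by (simp add: cauchy_def)

lemma cauchy_diff: "cauchy a \<Longrightarrow> k \<le> n \<Longrightarrow> a n \<ominus> a k \<in> P k"
  by (simp add: cauchy_def)

lemma cauchy_const: "r \<in> carrier R \<Longrightarrow> cauchy (\<lambda>_. r)"
  using additive_subgroup.zero_closed[OF ideal_power_additive_subgroup]
  by (simp add: cauchy_def a_minus_def r_neg)

lemma cauchy_add:
  assumes "cauchy a" "cauchy b"
  shows "cauchy (\<lambda>n. a n \<oplus> b n)"
  using assms additive_subgroup.a_closed[OF ideal_power_additive_subgroup]
  by (simp add: cauchy_def add_diff_add)

lemma cauchy_mult:
  assumes "cauchy a" "cauchy b"
  shows "cauchy (\<lambda>n. a n \<otimes> b n)"
  unfolding cauchy_def
proof (intro conjI allI impI)
  fix k n :: nat assume le: "k \<le> n"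
  interpret ideal "P k" R by (rule ideal_power_ideal)
  have c: "a n \<in> carrier R" "b n \<in> carrier R" "a k \<in> carrier R" "b k \<in> carrier R"
    using assms by (auto simp: cauchy_def)
  have "a n \<otimes> b n \<ominus> a k \<otimes> b k = a n \<otimes> (b n \<ominus> b k) \<oplus> (a n \<ominus> a k) \<otimes> b k"
    using c by algebra
  also have "\<dots> \<in> P k"
    using c cauchy_diff[OF assms(1) le] cauchy_diff[OF assms(2) le] I_l_closed I_r_closed by auto
  finally show "a n \<otimes> b n \<ominus> a k \<otimes> b k \<in> P k" .
qed (use assms in \<open>auto simp: cauchy_def\<close>)

lemma rlim_eq_iff:
  assumes "\<And>n. a n \<in> carrier R" "\<And>n. b n \<in> carrier R"
  shows "rlim a = rlim b \<longleftrightarrow> (\<forall>n. a n \<ominus> b n \<in> P n)"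
  using abelian_subgroup.a_rcos_eq_iff[OF ideal_power_abelian_subgroup assms]
  by (simp add: rlim_def fun_eq_iff)

lemma completion_ring_carrier: "carrier S = {rlim a | a. cauchy a}"
proof -
  have "A \<in> carrier S \<longleftrightarrow> (\<exists>a. A = rlim a \<and> cauchy a)" for A
    using compatible_cosets_iff[OF ideal_power_additive_subgroup ideal_power_antimono, where X = A]
    unfolding completion_ring_def FactRing_def rlim_def cauchy_def by auto
  then show ?thesis by blast
qed

lemma completion_ring_add:
  "cauchy a \<Longrightarrow> cauchy b \<Longrightarrow> rlim a \<oplus>\<^bsub>S\<^esub> rlim b = rlim (\<lambda>n. a n \<oplus> b n)"
  by (simp add: completion_ring_def FactRing_def rlim_def cauchy_closed
      abelian_subgroup.a_rcos_sum[OF ideal_power_abelian_subgroup])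

lemma completion_ring_mult:
  "cauchy a \<Longrightarrow> cauchy b \<Longrightarrow> rlim a \<otimes>\<^bsub>S\<^esub> rlim b = rlim (\<lambda>n. a n \<otimes> b n)"
  by (simp add: completion_ring_def FactRing_def rlim_def cauchy_closed
      ideal.rcoset_mult_add[OF ideal_power_ideal])

lemma completion_ring_one: "\<one>\<^bsub>S\<^esub> = rlim (\<lambda>_. \<one>)"
  by (simp add: completion_ring_def FactRing_def rlim_def)

lemma completion_ring_zero: "\<zero>\<^bsub>S\<^esub> = rlim (\<lambda>_. \<zero>)"
  using additive_subgroup.a_subset[OF ideal_power_additive_subgroup]
  by (simp add: completion_ring_def FactRing_def rlim_def)

lemma completion_ring_cases:
  assumes "A \<in> carrier S"
  obtains a where "cauchy a" "A = rlim a"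
  using assms unfolding completion_ring_carrier by blast

lemma rlim_closed: "cauchy a \<Longrightarrow> rlim a \<in> carrier S"
  unfolding completion_ring_carrier by blast

lemmas completion_ring_ops =
  completion_ring_add completion_ring_mult completion_ring_one completion_ring_zero
  cauchy_add cauchy_mult cauchy_const rlim_closed cauchy_closed

lemma cring_completion_ring: "cring S"
proof (rule cringI)
  show "abelian_group S"
  proof (rule abelian_groupI)
    fix A assume "A \<in> carrier S"
    then obtain a where a: "cauchy a" "A = rlim a" by (rule completion_ring_cases)
    have "cauchy (\<lambda>n. (\<ominus> \<one>) \<otimes> a n)" using a by (intro cauchy_mult cauchy_const) auto
    moreover from this have "rlim (\<lambda>n. (\<ominus> \<one>) \<otimes> a n) \<oplus>\<^bsub>S\<^esub> A = \<zero>\<^bsub>S\<^esub>"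
      using a by (simp add: completion_ring_ops l_minus l_neg)
    ultimately show "\<exists>B\<in>carrier S. B \<oplus>\<^bsub>S\<^esub> A = \<zero>\<^bsub>S\<^esub>" using rlim_closed by blast
  qed (auto elim!: completion_ring_cases simp: completion_ring_ops a_ac)
  show "comm_monoid S"
    by (rule comm_monoidI) (auto elim!: completion_ring_cases simp: completion_ring_ops m_ac)
qed (auto elim!: completion_ring_cases simp: completion_ring_ops l_distr)

definition emb :: "'a \<Rightarrow> nat \<Rightarrow> 'a set" where
  "emb r = rlim (\<lambda>_. r)"

lemma emb_ring_hom: "emb \<in> ring_hom R S"
  by (rule ring_hom_memI) (auto simp: emb_def completion_ring_ops)

text \<open>Terms of positive index differ from \<open>a 1\<close> by elements of \<open>I\<close>,
  which are nonunits; as nonunits are closed under addition, all these terms are units, and their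
  inverses again form a Cauchy sequence.\<close>

lemma completion_ring_Units:
  assumes I: "I \<inter> Units R = {}" and a: "cauchy a" "a (Suc 0) \<in> Units R"
    and nonunits: "\<And>x y. x \<in> carrier R \<Longrightarrow> y \<in> carrier R \<Longrightarrow> x \<notin> Units R \<Longrightarrow> y \<notin> Units R
      \<Longrightarrow> x \<oplus> y \<notin> Units R"
  shows "rlim a \<in> Units S"
proof -
  note ac = cauchy_closed[OF a(1)]
  have unit: "a (Suc n) \<in> Units R" for n
  proof (rule ccontr)
    assume n: "a (Suc n) \<notin> Units R"
    have "a (Suc n) \<ominus> a (Suc 0) \<in> I"
      using cauchy_diff[OF a(1), of "Suc 0" "Suc n"] ideal_power_Suc_subset[of 0] by auto
    then have "\<ominus> (a (Suc n) \<ominus> a (Suc 0)) \<in> I"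
      using I_ideal additive_subgroup.a_inv_closed ideal.axioms(1) by metis
    moreover have "a (Suc n) \<oplus> \<ominus> (a (Suc n) \<ominus> a (Suc 0)) = a (Suc 0)"
      using ac[of "Suc n"] ac[of "Suc 0"] by algebra
    ultimately show False
      using nonunits[of "a (Suc n)" "\<ominus> (a (Suc n) \<ominus> a (Suc 0))"] n a(2) I ac
      by (metis a_inv_closed disjoint_iff minus_closed)
  qed
  \<comment> \<open>The shift avoids \<open>a 0\<close>, which is unconstrained because
    \<open>I^0 = R\<close>. It costs only the difference of \<open>a (Suc n)\<close> and
    \<open>a n\<close>, which lies in \<open>I^n\<close>.\<close>
  define b where "b n = inv (a (Suc n))" for n
  have bc: "b n \<in> carrier R" and ab: "a (Suc n) \<otimes> b n = \<one>" for n
    using unit[of n] by (auto simp: b_def)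
  have b: "cauchy b"
    unfolding cauchy_def
  proof (intro conjI allI impI)
    fix k n :: nat assume le: "k \<le> n"
    interpret ideal "P k" R by (rule ideal_power_ideal)
    have "a (Suc n) \<ominus> a (Suc k) \<in> P k"
      using cauchy_diff[OF a(1), of "Suc k" "Suc n"] le ideal_power_antimono[of k "Suc k"] by auto
    then have "(\<ominus> (b n \<otimes> b k)) \<otimes> (a (Suc n) \<ominus> a (Suc k)) \<in> P k"
      using bc by (intro I_l_closed) auto
    \<comment> \<open>The usual identity for a difference of inverses, with
      \<open>a (Suc n) b n\<close> and \<open>a (Suc k) b k\<close> still to be replaced by
      1.\<close>
    also have "(\<ominus> (b n \<otimes> b k)) \<otimes> (a (Suc n) \<ominus> a (Suc k))
        = b n \<otimes> (a (Suc k) \<otimes> b k) \<ominus> (a (Suc n) \<otimes> b n) \<otimes> b k"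
      using bc[of n] bc[of k] ac[of "Suc n"] ac[of "Suc k"] by algebra
    also have "\<dots> = b n \<ominus> b k" using bc by (simp add: ab)
    finally show "b n \<ominus> b k \<in> P k" .
  qed (rule bc)
  interpret S: cring S by (rule cring_completion_ring)
  have "rlim a \<otimes>\<^bsub>S\<^esub> rlim b = \<one>\<^bsub>S\<^esub>"
    unfolding completion_ring_mult[OF a(1) b] completion_ring_one
  proof (subst rlim_eq_iff)
    show "\<forall>n. a n \<otimes> b n \<ominus> \<one> \<in> P n"
    proof
      fix n
      interpret ideal "P n" R by (rule ideal_power_ideal)
      have "(\<ominus> b n) \<otimes> (a (Suc n) \<ominus> a n) \<in> P n"
        using cauchy_diff[OF a(1), of n "Suc n"] bc by (intro I_l_closed) auto
      also have "(\<ominus> b n) \<otimes> (a (Suc n) \<ominus> a n) = a n \<otimes> b n \<ominus> a (Suc n) \<otimes> b n"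
        using bc[of n] ac[of "Suc n"] ac[of n] by algebra
      finally show "a n \<otimes> b n \<ominus> \<one> \<in> P n" by (simp add: ab)
    qed
  qed (use ac bc in auto)
  then show ?thesis
    using rlim_closed[OF a(1)] rlim_closed[OF b] S.m_comm unfolding Units_def by fastforce
qed

text \<open>If a nonunit \<open>A\<close> were outside \<open>\<nn>\<close>, then 1 would be the sum
  of an element of \<open>\<nn>\<close> and a multiple of \<open>A\<close>, both nonunits. Read
  modulo \<open>I\<close>, this writes 1 in \<open>R\<close> as a sum of three nonunits: one
  representative of each summand and an error in \<open>I\<close>.\<close>

lemma completion_ring_maximalideal_Units:
  assumes I: "I \<inter> Units R = {}"
    and nonunits: "\<And>x y. x \<in> carrier R \<Longrightarrow> y \<in> carrier R \<Longrightarrow> x \<notin> Units R \<Longrightarrow> y \<notin> Units R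
      \<Longrightarrow> x \<oplus> y \<notin> Units R"
    and max: "maximalideal \<nn> S" and A: "A \<in> carrier S" "A \<notin> \<nn>"
  shows "A \<in> Units S"
proof -
  interpret S: cring S by (rule cring_completion_ring)
  interpret N: maximalideal \<nn> S by fact
  have lift: "a (Suc 0) \<notin> Units R" if "cauchy a" "rlim a \<notin> Units S" for a
    using completion_ring_Units[OF I that(1) _ nonunits] that(2) by blast
  show ?thesis
  proof (rule ccontr)
    assume nA: "A \<notin> Units S"
    let ?J = "\<nn> <+>\<^bsub>S\<^esub> PIdl\<^bsub>S\<^esub> A"
    have J: "ideal ?J S"
      using S.add_ideals[OF N.is_ideal S.cgenideal_ideal[OF A(1)]] .
    interpret PA: ideal "PIdl\<^bsub>S\<^esub> A" S by (rule S.cgenideal_ideal[OF A(1)])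
    have "B \<in> ?J" if "B \<in> \<nn>" for B
    proof -
      have "B \<oplus>\<^bsub>S\<^esub> \<zero>\<^bsub>S\<^esub> \<in> ?J"
        using that PA.zero_closed unfolding set_add_def' by blast
      then show ?thesis using N.Icarr[OF that] by simp
    qed
    moreover have "A \<in> ?J"
    proof -
      have "\<zero>\<^bsub>S\<^esub> \<oplus>\<^bsub>S\<^esub> A \<in> ?J"
        using S.cgenideal_self[OF A(1)] N.zero_closed unfolding set_add_def' by blast
      then show ?thesis using A(1) by simp
    qed
    ultimately have "?J = carrier S"
      using N.I_maximal[OF J] A(2) ideal.Icarr[OF J] by blast
    then obtain B C where BC: "B \<in> \<nn>" "C \<in> carrier S" "\<one>\<^bsub>S\<^esub> = B \<oplus>\<^bsub>S\<^esub> C \<otimes>\<^bsub>S\<^esub> A"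
      using S.one_closed unfolding set_add_def' cgenideal_def by blast
    have "B \<notin> Units S"
    proof
      assume B: "B \<in> Units S"
      then have "inv\<^bsub>S\<^esub> B \<otimes>\<^bsub>S\<^esub> B \<in> \<nn>" using BC(1) by (intro N.I_l_closed) auto
      then show False using B N.one_imp_carrier N.I_notcarr by simp
    qed
    moreover have "C \<otimes>\<^bsub>S\<^esub> A \<notin> Units S"
      using nA BC(2) A(1) S.unit_factor by (metis S.m_comm)
    moreover obtain b where b: "cauchy b" "B = rlim b"
      using N.Icarr[OF BC(1)] by (rule completion_ring_cases)
    moreover obtain c where c: "cauchy c" "C \<otimes>\<^bsub>S\<^esub> A = rlim c"
      using S.m_closed[OF BC(2) A(1)] by (rule completion_ring_cases)
    ultimately have nu: "b (Suc 0) \<notin> Units R" "c (Suc 0) \<notin> Units R"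
      using lift by auto
    \<comment> \<open>The error at level 1, the first level that carries information; it lies in
      \<open>I\<close> and is hence a nonunit.\<close>
    define d where "d = \<one> \<ominus> (b (Suc 0) \<oplus> c (Suc 0))"
    have bcc: "b (Suc 0) \<in> carrier R" "c (Suc 0) \<in> carrier R"
      using b c by (auto simp: cauchy_closed)
    have "rlim (\<lambda>_. \<one>) = rlim (\<lambda>n. b n \<oplus> c n)"
      using BC(3) b c by (simp add: completion_ring_ops)
    then have "d \<in> P (Suc 0)"
      using b(1) c(1) rlim_eq_iff[of "\<lambda>_. \<one>" "\<lambda>n. b n \<oplus> c n"] cauchy_closed
      unfolding d_def by blast
    then have "d \<in> I" using ideal_power_Suc_subset by blast
    then have d: "d \<notin> Units R" "d \<in> carrier R"
      using I ideal.Icarr[OF I_ideal] by auto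
    have "d \<oplus> (b (Suc 0) \<oplus> c (Suc 0)) = \<one>"
      using bcc unfolding d_def by algebra
    then show False
      using nonunits[OF d(2) _ d(1), of "b (Suc 0) \<oplus> c (Suc 0)"] nonunits[OF bcc nu] bcc
      by auto
  qed
qed

end

section \<open>The completed module and its two scalar actions\<close>

lemma ideal_smult_mono: "J \<subseteq> K \<Longrightarrow> ideal_smult M J \<subseteq> ideal_smult M K"
proof
  fix x assume "J \<subseteq> K" "x \<in> ideal_smult M J"
  from this(2,1) show "x \<in> ideal_smult M K"
    by induction (auto intro: ideal_smult.intros)
qed

locale adic_module = module R M + adic_ring R I for R (structure) and M (structure) and I
begin

abbreviation "N n \<equiv> adic_submodule R I M n"

lemma adic_submodule_submodule: "submodule (N n) R M"
  by (rule submodule_ideal_smult[OF ideal_power_ideal])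

lemma adic_submodule_antimono: "k \<le> n \<Longrightarrow> N n \<subseteq> N k"
  by (intro ideal_smult_mono ideal_power_antimono)

definition mcauchy where
  "mcauchy x \<longleftrightarrow> (\<forall>n. x n \<in> carrier M) \<and> (\<forall>k n. k \<le> n \<longrightarrow> x n \<ominus>\<^bsub>M\<^esub> x k \<in> N k)"

definition mlim where
  "mlim x = (\<lambda>n. N n +>\<^bsub>M\<^esub> x n)"

lemma mcauchy_closed: "mcauchy x \<Longrightarrow> x n \<in> carrier M"
  by (simp add: mcauchy_def)

lemma mcauchy_diff: "mcauchy x \<Longrightarrow> k \<le> n \<Longrightarrow> x n \<ominus>\<^bsub>M\<^esub> x k \<in> N k"
  by (simp add: mcauchy_def)

lemma mcauchy_const: "x \<in> carrier M \<Longrightarrow> mcauchy (\<lambda>_. x)"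
  using submodule_zero[OF adic_submodule_submodule]
  by (simp add: mcauchy_def a_minus_def M.r_neg)

lemma mcauchy_add:
  assumes "mcauchy x" "mcauchy y"
  shows "mcauchy (\<lambda>n. x n \<oplus>\<^bsub>M\<^esub> y n)"
  using assms submoduleE(5)[OF adic_submodule_submodule]
  by (simp add: mcauchy_def M.add_diff_add)

lemma mcauchy_smult:
  assumes a: "cauchy a" and x: "mcauchy x"
  shows "mcauchy (\<lambda>n. a n \<odot>\<^bsub>M\<^esub> x n)"
  unfolding mcauchy_def
proof (intro conjI allI impI)
  fix k n :: nat assume le: "k \<le> n"
  have "a n \<odot>\<^bsub>M\<^esub> x n \<ominus>\<^bsub>M\<^esub> a k \<odot>\<^bsub>M\<^esub> x k
      = a n \<odot>\<^bsub>M\<^esub> (x n \<ominus>\<^bsub>M\<^esub> x k) \<oplus>\<^bsub>M\<^esub> (a n \<ominus> a k) \<odot>\<^bsub>M\<^esub> x k"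
    using assms by (intro smult_diff) (auto simp: cauchy_closed mcauchy_closed)
  also have "\<dots> \<in> N k"
    using submoduleE(4)[OF adic_submodule_submodule cauchy_closed[OF a] mcauchy_diff[OF x le]]
      ideal_smult.smult[OF cauchy_diff[OF a le] mcauchy_closed[OF x]]
    by (rule submoduleE(5)[OF adic_submodule_submodule])
  finally show "a n \<odot>\<^bsub>M\<^esub> x n \<ominus>\<^bsub>M\<^esub> a k \<odot>\<^bsub>M\<^esub> x k \<in> N k" .
qed (use assms in \<open>auto simp: cauchy_closed mcauchy_closed\<close>)

lemma mlim_eq_iff:
  assumes "\<And>n. x n \<in> carrier M" "\<And>n. y n \<in> carrier M"
  shows "mlim x = mlim y \<longleftrightarrow> (\<forall>n. x n \<ominus>\<^bsub>M\<^esub> y n \<in> N n)"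
  using abelian_subgroup.a_rcos_eq_iff[OF submodule_abelian_subgroup[OF adic_submodule_submodule] assms]
  by (simp add: mlim_def fun_eq_iff)

lemma completion_carrier: "carrier (completion R I M) = {mlim x | x. mcauchy x}"
proof -
  have "X \<in> carrier (completion R I M) \<longleftrightarrow> (\<exists>x. X = mlim x \<and> mcauchy x)" for X
    using M.compatible_cosets_iff[OF submodule_additive_subgroup[OF adic_submodule_submodule]
        adic_submodule_antimono, where X = X]
    unfolding completion_def quotient_module_def mlim_def mcauchy_def by auto
  then show ?thesis by blast
qed

abbreviation "H \<equiv> completion_hat R I M"

lemma hat_carrier: "carrier H = {mlim x | x. mcauchy x}"
  by (simp add: completion_hat_def completion_carrier)

lemma hat_add: "mcauchy x \<Longrightarrow> mcauchy y \<Longrightarrow> mlim x \<oplus>\<^bsub>H\<^esub> mlim y = mlim (\<lambda>n. x n \<oplus>\<^bsub>M\<^esub> y n)"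
  by (simp add: completion_hat_def completion_def quotient_module_def mlim_def mcauchy_closed
      abelian_subgroup.a_rcos_sum[OF submodule_abelian_subgroup[OF adic_submodule_submodule]])

lemma hat_zero: "\<zero>\<^bsub>H\<^esub> = mlim (\<lambda>_. \<zero>\<^bsub>M\<^esub>)"
  using submoduleE(1)[OF adic_submodule_submodule]
  by (simp add: completion_hat_def completion_def quotient_module_def mlim_def)

text \<open>Changing \<open>r\<close> by \<open>a\<close> in \<open>I^n\<close> changes
  \<open>r x\<close> by \<open>a x\<close>, which lies in \<open>I^n M\<close>.\<close>

lemma ideal_coset_smult:
  assumes r: "r \<in> carrier R" and x: "x \<in> carrier M"
  shows "coset_smult M (N n) (P n +> r) (N n +>\<^bsub>M\<^esub> x) = N n +>\<^bsub>M\<^esub> (r \<odot>\<^bsub>M\<^esub> x)"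
proof (rule coset_smult_coset[OF adic_submodule_submodule])
  interpret abelian_subgroup "P n" R by (rule ideal_power_abelian_subgroup)
  show "P n +> r \<subseteq> carrier R" using r by (auto simp: a_r_coset_def' a_Hcarr)
  show "r \<in> P n +> r" using r by (rule a_rcos_self)
  fix b assume "b \<in> P n +> r"
  then obtain a where a: "a \<in> P n" "b = a \<oplus> r" by (auto simp: a_r_coset_def')
  have "b \<odot>\<^bsub>M\<^esub> x \<ominus>\<^bsub>M\<^esub> r \<odot>\<^bsub>M\<^esub> x = a \<odot>\<^bsub>M\<^esub> x"
    using a r x a_Hcarr[OF a(1)] by (simp add: smult_l_distr a_minus_def M.a_assoc M.r_neg)
  then show "b \<odot>\<^bsub>M\<^esub> x \<ominus>\<^bsub>M\<^esub> r \<odot>\<^bsub>M\<^esub> x \<in> N n"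
    using ideal_smult.smult[OF a(1) x] by simp
qed (rule x)

lemma hat_smult: "cauchy a \<Longrightarrow> mcauchy x \<Longrightarrow> rlim a \<odot>\<^bsub>H\<^esub> mlim x = mlim (\<lambda>n. a n \<odot>\<^bsub>M\<^esub> x n)"
  by (simp add: completion_hat_def rlim_def mlim_def cauchy_closed mcauchy_closed ideal_coset_smult)

lemma completion_smult:
  assumes "r \<in> carrier R" "mcauchy x"
  shows "r \<odot>\<^bsub>completion R I M\<^esub> mlim x = mlim (\<lambda>n. r \<odot>\<^bsub>M\<^esub> x n)"
proof -
  have "coset_smult M (N n) {r} (N n +>\<^bsub>M\<^esub> x n) = N n +>\<^bsub>M\<^esub> (r \<odot>\<^bsub>M\<^esub> x n)" for n
    using assms submodule_zero[OF adic_submodule_submodule]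
    by (intro coset_smult_coset[OF adic_submodule_submodule])
      (auto simp: mcauchy_closed a_minus_def M.r_neg)
  then show ?thesis by (simp add: completion_def quotient_module_def mlim_def)
qed

lemma hat_cases:
  assumes "X \<in> carrier H"
  obtains x where "mcauchy x" "X = mlim x"
  using assms unfolding hat_carrier by blast

lemma mlim_closed: "mcauchy x \<Longrightarrow> mlim x \<in> carrier H"
  unfolding hat_carrier by blast

lemmas hat_ops = hat_add hat_smult hat_zero mcauchy_add mcauchy_smult mcauchy_const mlim_closed
  mcauchy_closed

lemma module_completion_hat: "module S H"
proof (rule moduleI)
  show "cring S" by (rule cring_completion_ring)
  show "abelian_group H"
  proof (rule abelian_groupI)
    fix X assume "X \<in> carrier H"
    then obtain x where x: "mcauchy x" "X = mlim x" by (rule hat_cases)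
    have "mcauchy (\<lambda>n. (\<ominus> \<one>) \<odot>\<^bsub>M\<^esub> x n)" using x by (intro mcauchy_smult cauchy_const) auto
    moreover from this have "mlim (\<lambda>n. (\<ominus> \<one>) \<odot>\<^bsub>M\<^esub> x n) \<oplus>\<^bsub>H\<^esub> X = \<zero>\<^bsub>H\<^esub>"
      using x by (simp add: hat_ops smult_l_minus M.l_neg)
    ultimately show "\<exists>Y\<in>carrier H. Y \<oplus>\<^bsub>H\<^esub> X = \<zero>\<^bsub>H\<^esub>" using mlim_closed by blast
  qed (auto elim!: hat_cases simp: hat_ops M.a_ac)
qed (auto elim!: completion_ring_cases hat_cases
    simp: completion_ring_ops hat_ops smult_l_distr smult_r_distr smult_assoc1)

text \<open>Identifies the \<open>R\<close>-action with the restriction along \<open>emb\<close>,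
  the link between the two structures that \<open>module_pullback\<close> and the change of rings
  rely on.\<close>

lemma emb_smult:
  "r \<in> carrier R \<Longrightarrow> X \<in> carrier H \<Longrightarrow> r \<odot>\<^bsub>completion R I M\<^esub> X = emb r \<odot>\<^bsub>H\<^esub> X"
  by (auto elim!: hat_cases simp: emb_def completion_smult hat_smult cauchy_const)

end


section \<open>Completions of reflexive modules\<close>

lemma matlis_reflexive_imp_quasi_complete:
  assumes "matlis R E u" and "adic_ring R I" and refl: "matlis_reflexive R E M"
  shows "quasi_complete R I M"
proof -
  interpret ER: matlis R E u by fact
  interpret adic_ring R I by fact
  have "module R M" using refl by (simp add: ER.matlis_reflexive_iff)
  then interpret adic_module R M I by (intro adic_module.intro adic_ring_axioms)
  show ?thesis
    unfolding quasi_complete_def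
  proof (intro equalityI subsetI)
    fix X assume "X \<in> completion_map R I M ` carrier M"
    then obtain x where "x \<in> carrier M" "X = mlim (\<lambda>_. x)"
      by (auto simp: completion_map_def mlim_def)
    then show "X \<in> carrier (completion R I M)"
      using mcauchy_const unfolding completion_carrier by blast
  next
    fix X assume "X \<in> carrier (completion R I M)"
    then obtain x where x: "mcauchy x" "X = mlim x" unfolding completion_carrier by blast
    obtain y where y: "y \<in> carrier M" "\<And>n. y \<ominus>\<^bsub>M\<^esub> x n \<in> N n"
      using ER.reflexive_linearly_compact[of M N x, OF refl adic_submodule_submodule
          adic_submodule_antimono mcauchy_closed[OF x(1)] mcauchy_diff[OF x(1)]] by blast
    then have "mlim (\<lambda>_. y) = X"
      using x by (simp add: mlim_eq_iff mcauchy_closed)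
    then have "completion_map R I M y = X" using y(1) by (simp add: completion_map_def mlim_def)
    then show "X \<in> completion_map R I M ` carrier M" using y(1) by blast
  qed
qed

text \<open>Linear compactness for the filtration \<open>I\<^sup>n x\<close> shows that \<open>R x\<close> is already complete.\<close>

lemma completion_hat_scalars:
  assumes "matlis R E u" and "adic_ring R I" and refl: "matlis_reflexive R E M"
    and A: "A \<in> carrier (completion_ring R I)" and X: "X \<in> carrier (completion_hat R I M)"
  shows "\<exists>r\<in>carrier R. A \<odot>\<^bsub>completion_hat R I M\<^esub> X
    = adic_ring.emb R I r \<odot>\<^bsub>completion_hat R I M\<^esub> X"
proof -
  interpret ER: matlis R E u by fact
  interpret adic_ring R I by fact
  have "module R M" using refl by (simp add: ER.matlis_reflexive_iff)
  then interpret adic_module R M I by (intro adic_module.intro adic_ring_axioms)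
  obtain a where a: "cauchy a" "A = rlim a" using A by (rule completion_ring_cases)
  have "X \<in> carrier (completion R I M)" using X by (simp add: completion_hat_def)
  then have "X \<in> completion_map R I M ` carrier M"
    using matlis_reflexive_imp_quasi_complete[OF assms(1-3)] by (simp add: quasi_complete_def)
  then obtain x where x: "x \<in> carrier M" "X = mlim (\<lambda>_. x)"
    by (auto simp: completion_map_def mlim_def)
  \<comment> \<open>By quasi-completeness \<open>X\<close> comes from a single \<open>x\<close>, so
    \<open>A X\<close> is represented by the sequence \<open>a n x\<close>. Its limit is sought
    along \<open>I^n x\<close> instead of the larger \<open>I^n M\<close>, to keep it inside
    \<open>R x\<close>.\<close>
  define K where "K n = (\<lambda>r. r \<odot>\<^bsub>M\<^esub> x) ` P n" for n
  have K: "submodule (K n) R M" for n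
    unfolding K_def using ideal_power_ideal x(1) by (rule submodule_multiples)
  have K_antimono: "K n \<subseteq> K k" if "k \<le> n" for k n
    unfolding K_def using ideal_power_antimono[OF that] by (rule image_mono)
  have K_N: "K n \<subseteq> N n" for n
    using x(1) by (auto simp: K_def intro: ideal_smult.smult)
  have diff: "a n \<odot>\<^bsub>M\<^esub> x \<ominus>\<^bsub>M\<^esub> a k \<odot>\<^bsub>M\<^esub> x = (a n \<ominus>\<^bsub>R\<^esub> a k) \<odot>\<^bsub>M\<^esub> x" for k n
    using smult_diff[of "a n" "a k" x x] a(1) x(1)
    by (simp add: cauchy_closed M.diff_eq_zero_iff[THEN iffD2])
  obtain y where y: "y \<in> carrier M" "\<And>n. y \<ominus>\<^bsub>M\<^esub> a n \<odot>\<^bsub>M\<^esub> x \<in> K n"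
  proof (rule ER.reflexive_linearly_compact[of M K "\<lambda>n. a n \<odot>\<^bsub>M\<^esub> x", OF refl K K_antimono])
    show "a n \<odot>\<^bsub>M\<^esub> x \<ominus>\<^bsub>M\<^esub> a k \<odot>\<^bsub>M\<^esub> x \<in> K k" if "k \<le> n" for k n
      unfolding diff K_def using cauchy_diff[OF a(1) that] by blast
  qed (use a(1) x(1) in \<open>auto simp: cauchy_closed\<close>)
  \<comment> \<open>Level 0 suffices: since \<open>I^0 = R\<close>, it places
    \<open>y - a 0 x\<close> in \<open>R x\<close>, and therefore \<open>y\<close> too.\<close>
  obtain r where r: "r \<in> carrier R" "y \<ominus>\<^bsub>M\<^esub> a 0 \<odot>\<^bsub>M\<^esub> x = r \<odot>\<^bsub>M\<^esub> x"
    using y(2)[of 0] unfolding K_def ideal_power_0 by blast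
  define s where "s = r \<oplus>\<^bsub>R\<^esub> a 0"
  have s: "s \<in> carrier R" using r a(1) by (simp add: s_def cauchy_closed)
  have "y = (y \<ominus>\<^bsub>M\<^esub> a 0 \<odot>\<^bsub>M\<^esub> x) \<oplus>\<^bsub>M\<^esub> a 0 \<odot>\<^bsub>M\<^esub> x"
    using y(1) x(1) cauchy_closed[OF a(1)] by (simp add: a_minus_def M.a_assoc M.l_neg)
  also have "\<dots> = s \<odot>\<^bsub>M\<^esub> x"
    using r x(1) cauchy_closed[OF a(1)] by (simp add: s_def smult_l_distr)
  finally have y_eq: "y = s \<odot>\<^bsub>M\<^esub> x" .
  have "emb s \<odot>\<^bsub>H\<^esub> X = mlim (\<lambda>_. y)"
    using s x by (simp add: emb_def hat_smult cauchy_const mcauchy_const y_eq)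
  \<comment> \<open>Each \<open>I^n x\<close> lies in \<open>I^n M\<close>, so the limit along the
    finer filtration is also the limit in the completion.\<close>
  also have "\<dots> = mlim (\<lambda>n. a n \<odot>\<^bsub>M\<^esub> x)"
    using y K_N a(1) x(1) by (subst mlim_eq_iff) (auto simp: cauchy_closed)
  also have "\<dots> = A \<odot>\<^bsub>H\<^esub> X"
    using a x by (simp add: hat_smult mcauchy_const)
  finally show ?thesis using s by metis
qed

theorem theorem1p1:
  fixes R :: "('a, 'r) ring_scheme" and \<mm> I :: "'a set"
    and M :: "('a, 'b, 'm) module_scheme" and E :: "('a, 'e, 'x) module_scheme"
  assumes "local_noetherian_ring R \<mm>"
    and "injective_hull R (residue_field_module R \<mm>) E"
    and "ideal I R" and "I \<noteq> carrier R"
    and "matlis_reflexive R E M"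
  shows "quasi_complete R I M \<and>
    (\<forall>\<nn> (E' :: (nat \<Rightarrow> 'a set, 'f, 'y) module_scheme).
       maximalideal \<nn> (completion_ring R I) \<and>
       injective_hull (completion_ring R I) (residue_field_module (completion_ring R I) \<nn>) E'
       \<longrightarrow> matlis_reflexive (completion_ring R I) E' (completion_hat R I M)) \<and>
    matlis_reflexive R E (completion R I M)"
proof -
  have max: "maximalideal \<mm> R" and cring: "cring R"
    using assms(1) by (auto simp: local_noetherian_ring_def)
  note Units = local_noetherian_ring_Units[OF assms(1)]
  obtain u where u: "matlis R E u"
    using injective_hull_imp_matlis[OF max Units assms(2)] by blast
  interpret ER: matlis R E u by (rule u)
  interpret m: maximalideal \<mm> R by (rule max)
  have adic: "adic_ring R I"
    using cring assms(3) by (simp add: adic_ring_def adic_ring_axioms_def)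
  interpret adic_ring R I by (rule adic)
  have M: "module R M" using assms(5) by (simp add: ER.matlis_reflexive_iff)
  interpret adic_module R M I using M adic by (rule adic_module.intro)
  have proper: "J \<inter> Units R = {}" if J: "ideal J R" "J \<noteq> carrier R" for J
  proof -
    interpret J: ideal J R by (rule J(1))
    have False if "r \<in> J" "r \<in> Units R" for r
    proof -
      have "inv\<^bsub>R\<^esub> r \<otimes>\<^bsub>R\<^esub> r \<in> J" using that by (intro J.I_l_closed) auto
      then show False using that(2) J.one_imp_carrier J(2) by simp
    qed
    then show ?thesis by blast
  qed
  \<comment> \<open>Nonunits lie in \<open>\<mm>\<close>, which is closed under addition and, being
    proper, contains no unit.\<close>
  have nonunits: "x \<oplus>\<^bsub>R\<^esub> y \<notin> Units R"
    if "x \<in> carrier R" "y \<in> carrier R" "x \<notin> Units R" "y \<notin> Units R" for x y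
  proof -
    have "x \<oplus>\<^bsub>R\<^esub> y \<in> \<mm>" using that Units m.a_closed by blast
    then show ?thesis using proper[OF m.is_ideal] m.I_notcarr by blast
  qed
  have quasi: "quasi_complete R I M"
    using u adic assms(5) by (rule matlis_reflexive_imp_quasi_complete)
  \<comment> \<open>The \<open>R\<close>-module axioms are inherited from the structure over the
    completed ring by restriction along \<open>emb\<close>.\<close>
  have completion: "module R (completion R I M)"
    using cring emb_ring_hom module_completion_hat
    by (rule module_pullback) (auto simp: completion_hat_def emb_smult[unfolded completion_hat_def])
  have "completion_map R I M \<in> module_hom R M (completion R I M)"
  proof (rule module_homI)
    show "completion_map R I M x \<in> carrier (completion R I M)" if "x \<in> carrier M" for x
      using quasi that by (auto simp: quasi_complete_def)
    have map: "completion_map R I M x = mlim (\<lambda>_. x)" if "x \<in> carrier M" for x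
      using that by (simp add: completion_map_def mlim_def)
    show "completion_map R I M (x \<oplus>\<^bsub>M\<^esub> y)
        = completion_map R I M x \<oplus>\<^bsub>completion R I M\<^esub> completion_map R I M y"
      if "x \<in> carrier M" "y \<in> carrier M" for x y
      using hat_add[OF mcauchy_const mcauchy_const, OF that] that
      by (simp add: map completion_hat_def)
    show "completion_map R I M (r \<odot>\<^bsub>M\<^esub> x) = r \<odot>\<^bsub>completion R I M\<^esub> completion_map R I M x"
      if "r \<in> carrier R" "x \<in> carrier M" for r x
      using that by (simp add: map completion_smult mcauchy_const)
  qed (simp add: completion_map_def)
  then have refl: "matlis_reflexive R E (completion R I M)"
    using ER.reflexive_image[OF assms(5) completion] quasi by (simp add: quasi_complete_def)
  have "matlis_reflexive S E' H"
    if \<nn>: "maximalideal \<nn> S" and hull: "injective_hull S (residue_field_module S \<nn>) E'"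
    for \<nn> and E' :: "(nat \<Rightarrow> 'a set, 'f, 'y) module_scheme"
  proof -
    \<comment> \<open>Whichever maximal ideal \<open>\<nn>\<close> the hull belongs to, elements
      outside it are units, so \<open>E'\<close> has over the completed ring the properties that
      \<open>E\<close> has over \<open>R\<close>.\<close>
    obtain u' where u': "matlis S E' u'"
      using injective_hull_imp_matlis[OF \<nn> completion_ring_maximalideal_Units[OF
          proper[OF assms(3,4)] nonunits \<nn>] hull] by blast
    show ?thesis
    proof (rule matlis_reflexive_change_of_rings[OF u u' emb_ring_hom refl module_completion_hat])
      show "r \<odot>\<^bsub>completion R I M\<^esub> X = emb r \<odot>\<^bsub>H\<^esub> X"
        if "r \<in> carrier R" "X \<in> carrier (completion R I M)" for r X
        using that by (intro emb_smult) (simp_all add: completion_hat_def)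
      show "\<exists>r\<in>carrier R. A \<odot>\<^bsub>H\<^esub> X = emb r \<odot>\<^bsub>H\<^esub> X"
        if "A \<in> carrier S" "X \<in> carrier (completion R I M)" for A X
        using that by (intro completion_hat_scalars[OF u adic assms(5)])
          (simp_all add: completion_hat_def)
    qed (simp_all add: completion_hat_def)
  qed
  then show ?thesis using quasi refl by blast
qed

end
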